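(* (1) Let $H=K_2+K_2$ be the disjoint union of two edges and fix $p\in(0,1)$. Sample $G$ from $G(n,p)$ and let $X_H$ be the number of subgraphs of $G$ isomorphic to $H$, with standard deviation $\sigma_H$. Then \[\sup_x\mathbb{P}[X_H=x]\gtrsim_p n^{1/2}\sigma_H^{-1}.\] (2) There is a graph $H'$ on $64$ vertices such that, if $G$ is sampled from $G(n,1/2)$ and $X_{H'}$ is the number of induced subgraphs of $G$ isomorphic to $H'$, with standard deviation $\sigma_{H'}$, then \[\sup_x\mathbb{P}[X_{H'}=x]\gtrsim n^{1/2}\sigma_{H'}^{-1}.\]
   Context: $G(n,p)$ is the Erdős–Rényi random graph on $[n]$ with each edge present independently with probability $p$. $f\gtrsim g$ means $f\ge cg$ for a positive constant $c$ independent of $n$ (depending on subscripted parameters). *)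

theory Defs
  imports "HOL-Probability.Probability"
begin

definition all_edges :: "nat \<Rightarrow> nat set set" where
  "all_edges n = {e. \<exists>i j. i < n \<and> j < n \<and> i \<noteq> j \<and> e = {i, j}}"

definition gnp :: "nat \<Rightarrow> real \<Rightarrow> nat set set pmf" where
  "gnp n p = map_pmf (\<lambda>f. {e \<in> all_edges n. f e})
      (Pi_pmf (all_edges n) False (\<lambda>_. bernoulli_pmf p))"

definition graph_iso :: "nat set \<Rightarrow> nat set set \<Rightarrow> nat set \<Rightarrow> nat set set \<Rightarrow> bool" where
  "graph_iso V1 E1 V2 E2 \<longleftrightarrow>
     (\<exists>f. bij_betw f V1 V2 \<and>
          (\<forall>u\<in>V1. \<forall>v\<in>V1. {u, v} \<in> E1 \<longleftrightarrow> {f u, f v} \<in> E2))"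

definition sub_count :: "nat set \<Rightarrow> nat set set \<Rightarrow> nat \<Rightarrow> nat set set \<Rightarrow> nat" where
  "sub_count VH EH n E = card {(V', E'). V' \<subseteq> {..<n} \<and> E' \<subseteq> E \<and> (\<forall>e\<in>E'. e \<subseteq> V')
                                  \<and> graph_iso V' E' VH EH}"

definition ind_count :: "nat set \<Rightarrow> nat set set \<Rightarrow> nat \<Rightarrow> nat set set \<Rightarrow> nat" where
  "ind_count VH EH n E = card {S. S \<subseteq> {..<n} \<and> graph_iso S {e \<in> E. e \<subseteq> S} VH EH}"

definition two_K2_V :: "nat set" where "two_K2_V = {0, 1, 2, 3}"
definition two_K2_E :: "nat set set" where "two_K2_E = {{0, 1}, {2, 3}}"

definition max_point_prob :: "'a pmf \<Rightarrow> ('a \<Rightarrow> real) \<Rightarrow> real" where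
  "max_point_prob M X = (SUP x::real. measure_pmf.prob M {w. X w = x})"

definition std_dev :: "'a pmf \<Rightarrow> ('a \<Rightarrow> real) \<Rightarrow> real" where
  "std_dev M X = sqrt (measure_pmf.variance M X)"

end

theory Submission
  imports Defs
begin

text \<open>
  Let \<open>m\<close> be the number of edges of \<open>G\<close>, and let \<open>d\<close> be the exponent with \<open>\<sigma> = \<Theta>(n^d)\<close>, so that
  \<open>d = 3\<close> and \<open>d = 63\<close> in the two parts. In both parts the count is \<open>X = h(m) + R\<close> with a deterministic
  function \<open>h\<close> and a remainder satisfying \<open>E R^2 = O(n^(2d-3))\<close>. By Chebyshev's inequality the pair
  \<open>(m, X)\<close> lies with probability at least 1/2 in a set of \<open>O(n * n^(d-3/2))\<close> integer points, so some
  value of \<open>X\<close> has probability of order at least \<open>n^(1/2-d)\<close>; and \<open>\<sigma>\<close> is at least of order \<open>n^d\<close> by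
  the Cauchy-Schwarz inequality applied to the covariance of \<open>X\<close> and \<open>m\<close>.

  For two disjoint edges, \<open>X\<close> is the number of all pairs of edges minus the number of pairs sharing
  a vertex, and after centring the edge indicators the latter only contributes a sum of \<open>O(n^3)\<close>
  orthogonal terms.

  For induced copies of \<open>H'\<close> on \<open>k\<close> vertices, expand \<open>X\<close> into products of centred edge indicators,
  indexed by edge sets \<open>F\<close> of the complete graph on \<open>k\<close> vertices. Edge sets spanning at least five
  vertices contribute \<open>O(n^(2k-5))\<close> to the variance. The coefficient of an isomorphism type of \<open>F\<close> is
  the average over all placements of \<open>F\<close> of the product of the \<open>\<plusminus>1\<close> edge signs of \<open>H'\<close>. The
  graph \<open>H'\<close> is chosen such that this average vanishes for every \<open>F\<close> on at most four vertices, except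
  for the empty graph, single edges and pairs of disjoint edges, which are all determined by \<open>m\<close> up
  to the remainder.
\<close>

section \<open>Random graphs and point probabilities\<close>

lemma all_edgesI: "i < n \<Longrightarrow> j < n \<Longrightarrow> i \<noteq> j \<Longrightarrow> {i, j} \<in> all_edges n"
  by (auto simp: all_edges_def)

lemma all_edges_mono: "m \<le> n \<Longrightarrow> all_edges m \<subseteq> all_edges n"
  by (force simp: all_edges_def)

lemma finite_all_edges [simp, intro]: "finite (all_edges n)"
proof (rule finite_subset)
  show "all_edges n \<subseteq> Pow {..<n}" by (auto simp: all_edges_def)
qed simp

text \<open>The support consists of the functions with the default value \<open>False\<close>
  outside the edge set, that is, of the indicator functions of edge sets. With a finite sum in place
  of an integral, linearity and monotonicity of the expectation come without integrability
  conditions.\<close>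

lemma expectation_gnp:
  fixes f :: "nat set set \<Rightarrow> real"
  assumes "0 \<le> p" "p \<le> 1"
  shows "measure_pmf.expectation (gnp n p) f =
    (\<Sum>S\<in>Pow (all_edges n). (\<Prod>e\<in>all_edges n. if e \<in> S then p else 1 - p) * f S)"
proof -
  let ?A = "all_edges n"
  let ?M = "Pi_pmf ?A False (\<lambda>_. bernoulli_pmf p)"
  let ?H = "(\<lambda>S e. e \<in> S) ` Pow ?A"
  have inj: "inj_on (\<lambda>S e. e \<in> S) (Pow ?A)"
    by (rule inj_onI) (auto simp: fun_eq_iff)
  have supp: "h \<in> ?H" if "h \<in> set_pmf ?M" for h
  proof -
    have "\<And>e. e \<notin> ?A \<Longrightarrow> \<not> h e" using that by (auto simp: set_Pi_pmf PiE_dflt_def)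
    then have "h = (\<lambda>e. e \<in> {e. h e})" "{e. h e} \<in> Pow ?A" by auto
    then show ?thesis by blast
  qed
  have "measure_pmf.expectation (gnp n p) f = measure_pmf.expectation ?M (\<lambda>h. f {e \<in> ?A. h e})"
    by (simp add: gnp_def)
  also have "\<dots> = (\<Sum>h\<in>?H. f {e \<in> ?A. h e} * pmf ?M h)"
    by (rule integral_measure_pmf_real) (use supp in auto)
  also have "\<dots> = (\<Sum>S\<in>Pow ?A. f {e \<in> ?A. e \<in> S} * pmf ?M (\<lambda>e. e \<in> S))"
    by (simp add: sum.reindex[OF inj])
  also have "\<dots> = (\<Sum>S\<in>Pow ?A. (\<Prod>e\<in>?A. if e \<in> S then p else 1 - p) * f S)"
  proof (rule sum.cong)
    fix S assume S: "S \<in> Pow ?A"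
    then have "{e \<in> ?A. e \<in> S} = S" by auto
    moreover have "pmf ?M (\<lambda>e. e \<in> S) = (\<Prod>e\<in>?A. pmf (bernoulli_pmf p) (e \<in> S))"
      by (subst pmf_Pi) (use S in auto)
    moreover have "\<dots> = (\<Prod>e\<in>?A. if e \<in> S then p else 1 - p)"
      by (rule prod.cong) (use assms in auto)
    ultimately show "f {e \<in> ?A. e \<in> S} * pmf ?M (\<lambda>e. e \<in> S) = (\<Prod>e\<in>?A. if e \<in> S then p else 1 - p) * f S"
      by simp
  qed simp
  finally show ?thesis .
qed

text \<open>Multiplying out a product of two-term sums over all edge sets reproduces the weights of
  \<open>expectation_gnp\<close>; this is the independence of the edges.\<close>

lemma expectation_gnp_prod:
  fixes g :: "nat set \<Rightarrow> bool \<Rightarrow> real"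
  assumes "0 \<le> p" "p \<le> 1"
  shows "measure_pmf.expectation (gnp n p) (\<lambda>S. \<Prod>e\<in>all_edges n. g e (e \<in> S)) =
    (\<Prod>e\<in>all_edges n. p * g e True + (1 - p) * g e False)"
proof -
  let ?A = "all_edges n"
  have "measure_pmf.expectation (gnp n p) (\<lambda>S. \<Prod>e\<in>?A. g e (e \<in> S)) =
    (\<Sum>S\<in>Pow ?A. \<Prod>e\<in>?A. (if e \<in> S then p * g e True else (1 - p) * g e False))"
    unfolding expectation_gnp[OF assms] prod.distrib[symmetric]
    by (intro sum.cong prod.cong) auto
  also have "\<dots> = (\<Sum>S\<in>Pow ?A. (\<Prod>e\<in>S. p * g e True) * (\<Prod>e\<in>?A - S. (1 - p) * g e False))"
  proof (rule sum.cong)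
    fix S assume "S \<in> Pow ?A"
    then have "?A \<inter> {e. e \<in> S} = S" "?A \<inter> - {e. e \<in> S} = ?A - S" by auto
    then show "(\<Prod>e\<in>?A. (if e \<in> S then p * g e True else (1 - p) * g e False)) =
        (\<Prod>e\<in>S. p * g e True) * (\<Prod>e\<in>?A - S. (1 - p) * g e False)"
      by (subst prod.If_cases) auto
  qed simp
  also have "\<dots> = (\<Prod>e\<in>?A. p * g e True + (1 - p) * g e False)"
    by (rule prod_add[symmetric]) simp
  finally show ?thesis .
qed

section \<open>Expectations in the random graph and orthogonality of centred edge monomials\<close>

locale random_graph =
  fixes p :: real
  assumes p_pos: "0 < p" and p_less_1: "p < 1"
begin

abbreviation expect :: "nat \<Rightarrow> (nat set set \<Rightarrow> real) \<Rightarrow> real" where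
  "expect n f \<equiv> measure_pmf.expectation (gnp n p) f"

lemmas expect_eq = expectation_gnp[OF less_imp_le[OF p_pos] less_imp_le[OF p_less_1]]
lemmas expect_prod = expectation_gnp_prod[OF less_imp_le[OF p_pos] less_imp_le[OF p_less_1]]

lemma expect_cong: "(\<And>S. S \<subseteq> all_edges n \<Longrightarrow> f S = g S) \<Longrightarrow> expect n f = expect n g"
  unfolding expect_eq by (intro sum.cong) auto

lemma expect_mono: "(\<And>S. S \<subseteq> all_edges n \<Longrightarrow> f S \<le> g S) \<Longrightarrow> expect n f \<le> expect n g"
  unfolding expect_eq using p_pos p_less_1
  by (intro sum_mono mult_left_mono prod_nonneg) auto

lemma expect_add: "expect n (\<lambda>S. f S + g S) = expect n f + expect n g"
  unfolding expect_eq by (simp add: distrib_left sum.distrib)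

lemma expect_diff: "expect n (\<lambda>S. f S - g S) = expect n f - expect n g"
  unfolding expect_eq by (simp add: right_diff_distrib sum_subtractf)

lemma expect_cmult: "expect n (\<lambda>S. c * f S) = c * expect n f"
  unfolding expect_eq by (simp add: sum_distrib_left mult_ac)

lemma expect_sum: "expect n (\<lambda>S. \<Sum>i\<in>I. f i S) = (\<Sum>i\<in>I. expect n (f i))"
  unfolding expect_eq sum_distrib_left by (rule sum.swap)

lemma expect_nonneg: "(\<And>S. S \<subseteq> all_edges n \<Longrightarrow> 0 \<le> f S) \<Longrightarrow> 0 \<le> expect n f"
  using expect_mono[of n "\<lambda>_. 0" f] by simp

text \<open>The mean of the square of \<open>f - t * g\<close> is nonnegative for every
  \<open>t\<close>; the choice \<open>t = a / b\<close> minimises it.\<close>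

lemma expect_Cauchy_Schwarz:
  assumes "0 < expect n (\<lambda>S. (g S)\<^sup>2)"
  shows "(expect n (\<lambda>S. f S * g S))\<^sup>2 \<le> expect n (\<lambda>S. (f S)\<^sup>2) * expect n (\<lambda>S. (g S)\<^sup>2)"
proof -
  define a b t where "a = expect n (\<lambda>S. f S * g S)" and "b = expect n (\<lambda>S. (g S)\<^sup>2)" and "t = a / b"
  have b: "b > 0" using assms by (simp add: b_def)
  have "0 \<le> expect n (\<lambda>S. (f S - t * g S)\<^sup>2)" by (rule expect_nonneg) simp
  also have "\<dots> = expect n (\<lambda>S. (f S)\<^sup>2 - (2 * t) * (f S * g S) + t\<^sup>2 * (g S)\<^sup>2)"
    by (rule expect_cong) (simp add: power2_eq_square algebra_simps)
  also have "\<dots> = expect n (\<lambda>S. (f S)\<^sup>2) - 2 * t * a + t\<^sup>2 * b"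
    by (simp only: expect_add expect_diff expect_cmult a_def b_def)
  also have "\<dots> = expect n (\<lambda>S. (f S)\<^sup>2) - a\<^sup>2 / b"
    using b by (simp add: t_def power2_eq_square field_simps)
  finally show ?thesis
    using b unfolding a_def[symmetric] b_def[symmetric] by (simp add: field_simps)
qed

definition centred :: "nat set \<Rightarrow> nat set set \<Rightarrow> real" where
  "centred e S = of_bool (e \<in> S) - p"

text \<open>Up to normalisation, these are the elements of the \<open>p\<close>-biased Fourier-Walsh
  basis.\<close>

definition monomial :: "nat set set \<Rightarrow> nat set set \<Rightarrow> real" where
  "monomial F S = (\<Prod>e\<in>F. centred e S)"

text \<open>For edge sets on \<open>n\<close> vertices this is the deviation of the edge count from
  its mean. As a sum of monomials of degree one it is orthogonal to all monomials of other
  degrees.\<close>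

definition excess :: "nat \<Rightarrow> nat set set \<Rightarrow> real" where
  "excess n S = (\<Sum>e\<in>all_edges n. centred e S)"

lemma monomial_empty [simp]: "monomial {} S = 1"
  and monomial_singleton [simp]: "monomial {e} S = centred e S"
  by (simp_all add: monomial_def)

lemma excess_eq: "S \<subseteq> all_edges n \<Longrightarrow> excess n S = real (card S) - real (card (all_edges n)) * p"
  by (simp add: excess_def centred_def sum_subtractf Int_absorb1 sum_of_bool_eq)

text \<open>The edges are independent: an edge in both sets contributes the variance
  \<open>p * (1 - p)\<close>, an edge in exactly one of them contributes the mean of a centred
  indicator, which is zero.\<close>

lemma expect_monomial_mult:
  assumes "F \<subseteq> all_edges n" "F' \<subseteq> all_edges n"
  shows "expect n (\<lambda>S. monomial F S * monomial F' S) = (if F = F' then (p * (1 - p)) ^ card F else 0)"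
proof -
  let ?A = "all_edges n"
  let ?g = "\<lambda>e b. (if e \<in> F then of_bool b - p else 1) * (if e \<in> F' then of_bool b - p else 1) :: real"
  have mono: "monomial G S = (\<Prod>e\<in>?A. if e \<in> G then of_bool (e \<in> S) - p else 1)" if "G \<subseteq> ?A" for G S
    unfolding monomial_def centred_def
    by (rule prod.mono_neutral_cong_left) (use that in auto)
  have "expect n (\<lambda>S. monomial F S * monomial F' S) = expect n (\<lambda>S. \<Prod>e\<in>?A. ?g e (e \<in> S))"
    by (rule expect_cong) (simp add: mono assms prod.distrib)
  also have "\<dots> = (\<Prod>e\<in>?A. p * ?g e True + (1 - p) * ?g e False)"
    by (rule expect_prod)
  also have "\<dots> = (\<Prod>e\<in>?A. if e \<in> F \<and> e \<in> F' then p * (1 - p) else if e \<in> F \<or> e \<in> F' then 0 else 1)"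
    by (rule prod.cong) (auto simp: algebra_simps)
  also have "\<dots> = (if F = F' then (p * (1 - p)) ^ card F else 0)"
  proof (cases "F = F'")
    case True
    have "(\<Prod>e\<in>?A. if e \<in> F then p * (1 - p) else 1) = (\<Prod>e\<in>F. p * (1 - p))"
      by (rule prod.mono_neutral_cong_right) (use assms in auto)
    moreover have "(\<Prod>e\<in>?A. if e \<in> F \<and> e \<in> F' then p * (1 - p) else if e \<in> F \<or> e \<in> F' then 0 else 1) =
      (\<Prod>e\<in>?A. if e \<in> F then p * (1 - p) else 1)"
      by (rule prod.cong) (auto simp: True)
    ultimately show ?thesis using True by simp
  next
    case False
    then obtain e where "e \<in> F \<union> F'" "\<not> (e \<in> F \<and> e \<in> F')" by auto
    then have "(\<Prod>e\<in>?A. if e \<in> F \<and> e \<in> F' then p * (1 - p) else if e \<in> F \<or> e \<in> F' then 0 else 1) = 0"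
      using assms by (intro prod_zero) (auto intro!: bexI[of _ e])
    then show ?thesis using False by simp
  qed
  finally show ?thesis .
qed

lemma variance_factor: "0 < p * (1 - p)" "p * (1 - p) \<le> 1"
  using p_pos p_less_1 by (auto simp: mult_le_one)

text \<open>By orthogonality only pairs of equal monomials survive, each with weight at most one.
  The indexed family may repeat a monomial, so the bound counts coincidences.\<close>

lemma expect_sum_monomials_le:
  assumes "finite I" "\<And>i. i \<in> I \<Longrightarrow> \<Phi> i \<subseteq> all_edges n"
  shows "expect n (\<lambda>S. (\<Sum>i\<in>I. monomial (\<Phi> i) S)\<^sup>2) \<le> real (\<Sum>i\<in>I. card {j \<in> I. \<Phi> j = \<Phi> i})"
proof -
  have "expect n (\<lambda>S. (\<Sum>i\<in>I. monomial (\<Phi> i) S)\<^sup>2) =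
    (\<Sum>i\<in>I. \<Sum>j\<in>I. expect n (\<lambda>S. monomial (\<Phi> i) S * monomial (\<Phi> j) S))"
    unfolding power2_eq_square sum_product expect_sum ..
  also have "\<dots> = (\<Sum>i\<in>I. \<Sum>j\<in>I. if \<Phi> i = \<Phi> j then (p * (1 - p)) ^ card (\<Phi> i) else 0)"
    by (intro sum.cong refl expect_monomial_mult assms)
  also have "\<dots> \<le> (\<Sum>i\<in>I. \<Sum>j\<in>I. of_bool (\<Phi> j = \<Phi> i))"
    using variance_factor by (intro sum_mono) (auto simp: power_le_one)
  also have "\<dots> = real (\<Sum>i\<in>I. card {j \<in> I. \<Phi> j = \<Phi> i})"
    by (simp add: assms(1) sum_of_bool_eq Int_def)
  finally show ?thesis .
qed

lemma expect_centred: "e \<in> all_edges n \<Longrightarrow> expect n (centred e) = 0"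
  using expect_monomial_mult[of "{e}" n "{}"] by simp

lemma expect_excess: "expect n (excess n) = 0"
  unfolding excess_def[abs_def] expect_sum by (simp add: expect_centred)

lemma expect_excess_sq: "expect n (\<lambda>S. (excess n S)\<^sup>2) = real (card (all_edges n)) * (p * (1 - p))"
proof -
  have "expect n (\<lambda>S. (excess n S)\<^sup>2) =
    (\<Sum>e\<in>all_edges n. \<Sum>e'\<in>all_edges n. expect n (\<lambda>S. monomial {e} S * monomial {e'} S))"
    unfolding power2_eq_square excess_def sum_product expect_sum by simp
  also have "\<dots> = (\<Sum>e\<in>all_edges n. \<Sum>e'\<in>all_edges n. if e = e' then p * (1 - p) else 0)"
    by (intro sum.cong refl, subst expect_monomial_mult) auto
  also have "\<dots> = real (card (all_edges n)) * (p * (1 - p))"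
    by simp
  finally show ?thesis .
qed

end

section \<open>Large point probabilities from an approximation by a function of the edge
  count\<close>

lemma card_nat_interval_le:
  fixes r l :: real
  assumes "0 \<le> l"
  shows "finite {x::nat. \<bar>real x - r\<bar> < l}" "real (card {x::nat. \<bar>real x - r\<bar> < l}) \<le> 2 * l + 1"
proof -
  let ?J = "{\<lfloor>r - l\<rfloor> + 1..\<lceil>r + l\<rceil> - 1}"
  have sub: "int ` {x::nat. \<bar>real x - r\<bar> < l} \<subseteq> ?J"
  proof
    fix z assume "z \<in> int ` {x::nat. \<bar>real x - r\<bar> < l}"
    then obtain x :: nat where x: "z = int x" "real x < r + l" "r - l < real x" by (auto simp: abs_less_iff)
    then show "z \<in> ?J" by (simp, linarith)
  qed
  then have "finite (int ` {x::nat. \<bar>real x - r\<bar> < l})" by (rule finite_subset) simp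
  then show "finite {x::nat. \<bar>real x - r\<bar> < l}" by (simp add: finite_image_iff)
  have "card {x::nat. \<bar>real x - r\<bar> < l} = card (int ` {x::nat. \<bar>real x - r\<bar> < l})"
    by (simp add: card_image)
  also have "\<dots> \<le> card ?J" using sub by (intro card_mono) auto
  finally have "real (card {x::nat. \<bar>real x - r\<bar> < l}) \<le> real (card ?J)" by simp
  also have "\<dots> \<le> 2 * l + 1" using assms by (simp, linarith)
  finally show "real (card {x::nat. \<bar>real x - r\<bar> < l}) \<le> 2 * l + 1" .
qed

lemma prob_le_max_point_prob: "measure_pmf.prob M {w. X w = x} \<le> max_point_prob M X"
  unfolding max_point_prob_def
  by (rule cSUP_upper) (auto intro!: bdd_aboveI[of _ 1])

lemma card_all_edges_le: "card (all_edges n) \<le> n\<^sup>2"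
proof -
  have "all_edges n \<subseteq> (\<lambda>(i, j). {i, j}) ` ({..<n} \<times> {..<n})" by (auto simp: all_edges_def)
  then have "card (all_edges n) \<le> card ({..<n} \<times> {..<n})"
    by (rule surj_card_le[rotated]) auto
  then show ?thesis by (simp add: power2_eq_square)
qed

context random_graph
begin

text \<open>Pigeonhole principle: by Chebyshev's inequality the pair of the edge count and the value
  of \<open>X\<close> lies with probability at least 1/2 among at most
  \<open>5 * n * (2 * l + 1)\<close> points, and the probability of each point is at most the
  largest point probability of \<open>X\<close>.\<close>

lemma max_point_prob_ge:
  fixes X :: "nat set set \<Rightarrow> nat"
  assumes n: "n \<ge> 1" and l: "l > 0"
    and approx: "expect n (\<lambda>S. (real (X S) - h (card S))\<^sup>2) \<le> l\<^sup>2 / 4"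
  shows "1 \<le> 10 * real n * (2 * l + 1) * max_point_prob (gnp n p) (\<lambda>S. real (X S))"
proof -
  let ?m = "real (card (all_edges n)) * p"
  define P where "P = max_point_prob (gnp n p) (\<lambda>S. real (X S))"
  \<comment> \<open>The edge count has variance at most \<open>n^2\<close>, so it leaves a window of
    half-width \<open>2 * n\<close> with probability at most 1/4.\<close>
  define J where "J = {j::nat. \<bar>real j - ?m\<bar> < 2 * real n}"
  define I where "I j = {x::nat. \<bar>real x - h j\<bar> < l}" for j
  have J: "finite J" "real (card J) \<le> 4 * real n + 1"
    unfolding J_def using card_nat_interval_le[of "2 * real n" ?m] by auto
  have I: "finite (I j)" "real (card (I j)) \<le> 2 * l + 1" for j
    unfolding I_def using card_nat_interval_le[of l "h j"] l by auto
  have P: "expect n (\<lambda>S. of_bool (X S = x)) \<le> P" for x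
  proof -
    have "(\<lambda>S. of_bool (X S = x)) = (indicator {S. real (X S) = real x} :: _ \<Rightarrow> real)"
      by (auto simp: fun_eq_iff indicator_def)
    then have "expect n (\<lambda>S. of_bool (X S = x)) = measure_pmf.prob (gnp n p) {S. real (X S) = real x}"
      by simp
    then show ?thesis unfolding P_def by (simp only: prob_le_max_point_prob)
  qed
  have P0: "0 \<le> P"
    using order_trans[OF measure_nonneg prob_le_max_point_prob] unfolding P_def .
  \<comment> \<open>A pointwise union bound: if neither of the last two terms reaches 1, then some
    indicator in the double sum equals 1. Taking expectations yields both Chebyshev inequalities and
    the pigeonhole principle at once.\<close>
  have pointwise: "1 \<le> (\<Sum>j\<in>J. \<Sum>x\<in>I j. of_bool (X S = x)) + (1 / (4 * (real n)\<^sup>2)) * (excess n S)\<^sup>2 +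
      (1 / l\<^sup>2) * (real (X S) - h (card S))\<^sup>2" (is "1 \<le> ?a + ?b + ?c")
    if S: "S \<subseteq> all_edges n" for S
  proof -
    have a0: "?a \<ge> 0" by (intro sum_nonneg) auto
    have b0: "?b \<ge> 0" and c0: "?c \<ge> 0" by auto
    consider "2 * real n \<le> \<bar>excess n S\<bar>" | "l \<le> \<bar>real (X S) - h (card S)\<bar>" | "card S \<in> J" "X S \<in> I (card S)"
      unfolding J_def I_def using excess_eq[OF S] by fastforce
    then show ?thesis
    proof cases
      case 1
      then have "(2 * real n)\<^sup>2 \<le> (excess n S)\<^sup>2" by (subst abs_le_square_iff[symmetric]) simp
      then have "1 \<le> ?b" using n by (simp add: field_simps power2_eq_square)
      then show ?thesis using a0 c0 by linarith
    next
      case 2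
      then have "l\<^sup>2 \<le> (real (X S) - h (card S))\<^sup>2" using l by (subst abs_le_square_iff[symmetric]) simp
      then have "1 \<le> ?c" using l by (simp add: field_simps)
      then show ?thesis using a0 b0 by linarith
    next
      case 3
      have "1 = (of_bool (X S = X S) :: real)" by simp
      also have "\<dots> \<le> (\<Sum>x\<in>I (card S). of_bool (X S = x))"
        by (rule member_le_sum) (use 3 I in auto)
      also have "\<dots> \<le> ?a"
        by (rule member_le_sum) (use 3 J in \<open>auto intro!: sum_nonneg\<close>)
      finally show ?thesis using b0 c0 by linarith
    qed
  qed
  have "1 = expect n (\<lambda>_. 1)" by simp
  also have "\<dots> \<le> expect n (\<lambda>S. (\<Sum>j\<in>J. \<Sum>x\<in>I j. of_bool (X S = x)) + (1 / (4 * (real n)\<^sup>2)) * (excess n S)\<^sup>2 +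
      (1 / l\<^sup>2) * (real (X S) - h (card S))\<^sup>2)"
    by (rule expect_mono) (rule pointwise)
  also have "\<dots> = (\<Sum>j\<in>J. \<Sum>x\<in>I j. expect n (\<lambda>S. of_bool (X S = x))) +
      (1 / (4 * (real n)\<^sup>2)) * (real (card (all_edges n)) * (p * (1 - p))) +
      (1 / l\<^sup>2) * expect n (\<lambda>S. (real (X S) - h (card S))\<^sup>2)"
    by (simp only: expect_add expect_cmult expect_sum expect_excess_sq)
  also have "(1 / (4 * (real n)\<^sup>2)) * (real (card (all_edges n)) * (p * (1 - p))) \<le> 1 / 4"
  proof -
    have "real (card (all_edges n)) * (p * (1 - p)) \<le> (real n)\<^sup>2 * 1"
      using variance_factor card_all_edges_le[of n]
      by (intro mult_mono) (simp_all flip: of_nat_power)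
    then show ?thesis using n by (simp add: field_simps)
  qed
  also have "(1 / l\<^sup>2) * expect n (\<lambda>S. (real (X S) - h (card S))\<^sup>2) \<le> 1 / 4"
    using approx l by (simp add: field_simps)
  also have "(\<Sum>j\<in>J. \<Sum>x\<in>I j. expect n (\<lambda>S. of_bool (X S = x))) \<le> (\<Sum>j\<in>J. \<Sum>x\<in>I j. P)"
    by (intro sum_mono P)
  also have "\<dots> \<le> (\<Sum>j\<in>J. (2 * l + 1) * P)"
    using I P0 by (intro sum_mono) (simp add: mult_right_mono)
  also have "\<dots> \<le> (4 * real n + 1) * ((2 * l + 1) * P)"
    using J P0 l by (simp add: mult_right_mono)
  also have "\<dots> \<le> (5 * real n) * ((2 * l + 1) * P)"
    using n P0 l by (intro mult_right_mono) auto
  \<comment> \<open>The two Chebyshev terms are at most 1/4 each, and moving them to the left turns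
    the factor 5 into 10.\<close>
  finally show ?thesis unfolding P_def[symmetric] by (simp add: algebra_simps)
qed

text \<open>Cauchy-Schwarz against \<open>excess\<close>, whose second moment is at most
  \<open>n^2\<close>: the bound on the covariance loses one factor \<open>n\<close>.\<close>

lemma std_dev_ge:
  assumes n: "n \<ge> 2" and a: "0 \<le> a" and cov: "a * (real n) ^ (d + 1) \<le> \<bar>expect n (\<lambda>S. X S * excess n S)\<bar>"
  shows "a * real n ^ d \<le> std_dev (gnp n p) X"
proof -
  let ?\<mu> = "expect n X"
  let ?N = "real (card (all_edges n))"
  have "{0, 1} \<in> all_edges n" using n by (intro all_edgesI) auto
  then have "0 < ?N" by (auto simp: card_gt_0_iff)
  then have pos: "0 < expect n (\<lambda>S. (excess n S)\<^sup>2)" using variance_factor by (simp add: expect_excess_sq)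
  have le: "expect n (\<lambda>S. (excess n S)\<^sup>2) \<le> (real n)\<^sup>2"
  proof -
    have "?N * (p * (1 - p)) \<le> (real n)\<^sup>2 * 1"
      using variance_factor card_all_edges_le[of n]
      by (intro mult_mono) (simp_all flip: of_nat_power)
    then show ?thesis by (simp add: expect_excess_sq)
  qed
  \<comment> \<open>The excess has mean zero, so centring \<open>X\<close> does not change the
    covariance.\<close>
  have "expect n (\<lambda>S. (X S - ?\<mu>) * excess n S) = expect n (\<lambda>S. X S * excess n S - ?\<mu> * excess n S)"
    by (simp add: algebra_simps)
  also have "\<dots> = expect n (\<lambda>S. X S * excess n S)"
    by (simp only: expect_diff expect_cmult expect_excess)
  finally have cov': "expect n (\<lambda>S. (X S - ?\<mu>) * excess n S) = expect n (\<lambda>S. X S * excess n S)" by simp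
  have V0: "0 \<le> expect n (\<lambda>S. (X S - ?\<mu>)\<^sup>2)" by (rule expect_nonneg) simp
  have "(a * real n ^ d)\<^sup>2 * (real n)\<^sup>2 = (a * (real n) ^ (d + 1))\<^sup>2"
    by (simp add: power_mult_distrib power2_eq_square)
  also have "\<dots> \<le> (expect n (\<lambda>S. X S * excess n S))\<^sup>2"
    using cov a by (subst abs_le_square_iff[symmetric]) simp
  also have "\<dots> \<le> expect n (\<lambda>S. (X S - ?\<mu>)\<^sup>2) * expect n (\<lambda>S. (excess n S)\<^sup>2)"
    using expect_Cauchy_Schwarz[OF pos, of "\<lambda>S. X S - ?\<mu>"] unfolding cov' .
  also have "\<dots> \<le> expect n (\<lambda>S. (X S - ?\<mu>)\<^sup>2) * (real n)\<^sup>2"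
    using le V0 by (rule mult_left_mono)
  finally have "(a * real n ^ d)\<^sup>2 \<le> expect n (\<lambda>S. (X S - ?\<mu>)\<^sup>2)"
    using n by simp
  then show ?thesis unfolding std_dev_def by (rule real_le_rsqrt)
qed

text \<open>The function \<open>h\<close> is arbitrary and may change with \<open>n\<close>; only
  \<open>K\<close> is uniform. The case of interest is \<open>r = 2 * d - 3\<close>, in which the
  remainder is smaller than a standard deviation of order \<open>n^d\<close> by a factor of order
  \<open>n^(3/2)\<close>.\<close>

definition size_approximable :: "nat \<Rightarrow> (nat \<Rightarrow> nat set set \<Rightarrow> real) \<Rightarrow> bool" where
  "size_approximable r Z \<longleftrightarrow>
    (\<exists>K\<ge>0. \<forall>n. \<exists>h. expect n (\<lambda>S. (Z n S - h (card S))\<^sup>2) \<le> K * real n ^ r)"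

text \<open>The criterion behind both parts. A remainder of root mean square
  \<open>n^(d-3/2)\<close> leaves about \<open>n * n^(d-3/2)\<close> points for the pigeonhole
  argument of \<open>max_point_prob_ge\<close>. Of the standard deviation only the lower bound
  \<open>std_dev_ge\<close> is needed, since it stands in the denominator.\<close>

theorem anticoncentration_failure:
  fixes X :: "nat \<Rightarrow> nat set set \<Rightarrow> nat"
  assumes d: "d \<ge> 2" and approx: "size_approximable (2 * d - 3) (\<lambda>n S. real (X n S))"
    and a: "a > 0"
    and cov: "\<forall>\<^sub>F n in sequentially. a * (real n) ^ (d + 1) \<le> \<bar>expect n (\<lambda>S. real (X n S) * excess n S)\<bar>"
  shows "\<exists>c>0. \<forall>\<^sub>F n in sequentially.
    c * sqrt (real n) / std_dev (gnp n p) (\<lambda>S. real (X n S)) \<le> max_point_prob (gnp n p) (\<lambda>S. real (X n S))"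
proof -
  obtain K where K: "K \<ge> 0" "\<And>n. \<exists>h. expect n (\<lambda>S. (real (X n S) - h (card S))\<^sup>2) \<le> K * real n ^ (2 * d - 3)"
    using approx unfolding size_approximable_def by auto
  \<comment> \<open>Chosen so that \<open>2 * l + 1 \<le> B * w\<close> for the \<open>l\<close> and
    \<open>w\<close> below, because \<open>w \<ge> 1\<close>.\<close>
  define B where "B = 4 * sqrt (K + 1) + 1"
  have B: "B > 0" using K by (simp add: B_def add_nonneg_pos)
  define c where "c = a / (10 * B)"
  have c: "c > 0" using a B by (simp add: c_def)
  show ?thesis
  proof (intro exI[of _ c] conjI c)
    show "\<forall>\<^sub>F n in sequentially.
      c * sqrt (real n) / std_dev (gnp n p) (\<lambda>S. real (X n S)) \<le> max_point_prob (gnp n p) (\<lambda>S. real (X n S))"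
      using cov eventually_ge_at_top[of 2]
    proof eventually_elim
      case (elim n)
      let ?P = "max_point_prob (gnp n p) (\<lambda>S. real (X n S))"
      let ?s = "std_dev (gnp n p) (\<lambda>S. real (X n S))"
      have n: "real n \<ge> 1" using elim by simp
      define w where "w = sqrt (real n ^ (2 * d - 3))"
      \<comment> \<open>This makes \<open>l^2 / 4\<close> equal to
        \<open>(K + 1) * n^(2 * d - 3)\<close>; the summand 1 keeps \<open>l\<close> positive when
        \<open>K = 0\<close>.\<close>
      define l where "l = 2 * (sqrt (K + 1) * w)"
      have w: "w \<ge> 1" using n by (simp add: w_def)
      have l: "l > 0" using w K by (simp add: l_def)
      obtain h where h: "expect n (\<lambda>S. (real (X n S) - h (card S))\<^sup>2) \<le> K * real n ^ (2 * d - 3)"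
        using K by auto
      also have "\<dots> \<le> (K + 1) * real n ^ (2 * d - 3)" by (intro mult_right_mono) auto
      also have "\<dots> = l\<^sup>2 / 4"
        using K by (simp add: l_def w_def power_mult_distrib)
      finally have "1 \<le> 10 * real n * (2 * l + 1) * ?P"
        using elim l by (intro max_point_prob_ge) auto
      also have "\<dots> \<le> 10 * real n * (B * w) * ?P"
      proof -
        have "0 \<le> ?P" using order_trans[OF measure_nonneg prob_le_max_point_prob] .
        moreover have "2 * l + 1 \<le> B * w" using w by (simp add: B_def l_def algebra_simps)
        ultimately show ?thesis using n by (intro mult_right_mono mult_left_mono) auto
      qed
      finally have P: "1 \<le> 10 * real n * (B * w) * ?P" .
      \<comment> \<open>Here \<open>w\<close> is \<open>n^(d - 3/2)\<close>; the assumption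
        \<open>d \<ge> 2\<close> makes the truncated subtraction in its exponent exact.\<close>
      have nd: "real n ^ d = real n * w * sqrt (real n)"
      proof -
        have "(2 * d - 3) + 1 = 2 * (d - 1)" using d by simp
        then have "real n ^ (2 * d - 3) * real n = (real n ^ (d - 1))\<^sup>2"
          by (metis power_add power_mult power_one_right mult.commute)
        then have "w * sqrt (real n) = real n ^ (d - 1)"
          unfolding w_def real_sqrt_mult[symmetric] using n by simp
        then show ?thesis using d by (simp add: mult.assoc power_eq_if)
      qed
      have s: "a * real n ^ d \<le> ?s"
        using elim a by (intro std_dev_ge) auto
      have s0: "0 < a * real n ^ d" using a n by simp
      have "c * sqrt (real n) / ?s \<le> c * sqrt (real n) / (a * real n ^ d)"
        using s s0 c by (intro divide_left_mono) auto
      also have "\<dots> = 1 / (10 * real n * (B * w))"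
        using a B n w unfolding c_def nd by (simp add: field_simps)
      also have "\<dots> \<le> ?P"
        using P B n w by (simp add: field_simps)
      finally show ?case .
    qed
  qed
qed

end

section \<open>Pairs of disjoint edges\<close>

lemma all_edges_altdef: "all_edges n = {e. e \<subseteq> {..<n} \<and> card e = 2}"
  by (auto simp: all_edges_def card_2_iff)

lemma card_all_edges: "card (all_edges n) = n choose 2"
  unfolding all_edges_altdef by (simp add: n_subsets)

lemma card_disjoint_edges:
  assumes "e \<in> all_edges n"
  shows "card {f \<in> all_edges n. e \<inter> f = {}} = (n - 2) choose 2"
proof -
  have e: "e \<subseteq> {..<n}" "card e = 2" using assms by (auto simp: all_edges_altdef)
  have "{f \<in> all_edges n. e \<inter> f = {}} = {f. f \<subseteq> {..<n} - e \<and> card f = 2}"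
    by (auto simp: all_edges_altdef)
  moreover have "card ({..<n} - e) = n - 2"
    using e by (simp add: card_Diff_subset finite_subset)
  ultimately show ?thesis by (simp add: n_subsets)
qed

text \<open>The pairs are ordered, so every unordered pair of edges is listed twice; the same holds
  for \<open>cherries\<close>.\<close>

definition disjoint_pairs :: "nat \<Rightarrow> (nat set \<times> nat set) set" where
  "disjoint_pairs n = (SIGMA e:all_edges n. {f \<in> all_edges n. e \<inter> f = {}})"

definition cherries :: "nat \<Rightarrow> (nat set \<times> nat set) set" where
  "cherries n = (SIGMA e:all_edges n. {f \<in> all_edges n. e \<noteq> f \<and> e \<inter> f \<noteq> {}})"

lemma finite_pairs [simp]: "finite (disjoint_pairs n)" "finite (cherries n)"
  by (simp_all add: disjoint_pairs_def cherries_def)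

lemma all_edges_nonempty: "e \<in> all_edges n \<Longrightarrow> e \<noteq> {}"
  by (auto simp: all_edges_def)

text \<open>A common vertex and the two other endpoints determine the pair.\<close>

lemma card_cherries_le: "card (cherries n) \<le> n ^ 3"
proof -
  let ?T = "{..<n} \<times> {..<n} \<times> {..<n}"
  have "cherries n \<subseteq> (\<lambda>(a, b, c). ({a, b}, {a, c})) ` ?T"
  proof
    fix z assume "z \<in> cherries n"
    then obtain e f x where z: "z = (e, f)" "e \<in> all_edges n" "f \<in> all_edges n" "x \<in> e" "x \<in> f"
      by (auto simp: cherries_def)
    from z(2,4) obtain b where "e = {x, b}" "x < n" "b < n" by (auto simp: all_edges_def)
    moreover from z(3,5) obtain c where "f = {x, c}" "c < n" by (auto simp: all_edges_def)
    ultimately show "z \<in> (\<lambda>(a, b, c). ({a, b}, {a, c})) ` ?T"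
      unfolding z(1) by (intro image_eqI[where x = "(x, b, c)"]) auto
  qed
  then have "card (cherries n) \<le> card ?T" by (rule surj_card_le[rotated]) auto
  then show ?thesis by (simp add: power3_eq_cube)
qed

text \<open>Applied to edge indicators this gives the number of disjoint pairs in the graph; applied
  to centred indicators it gives the sum of the monomials of two disjoint edges.\<close>

lemma sum_edge_pairs:
  fixes f :: "nat set \<Rightarrow> nat set \<Rightarrow> real"
  shows "(\<Sum>e\<in>all_edges n. \<Sum>e'\<in>all_edges n. f e e') =
    (\<Sum>e\<in>all_edges n. f e e) + (\<Sum>(e, e')\<in>cherries n. f e e') + (\<Sum>(e, e')\<in>disjoint_pairs n. f e e')"
proof -
  have "(\<Sum>e'\<in>all_edges n. f e e') = f e e + (\<Sum>e'\<in>{e' \<in> all_edges n. e \<noteq> e' \<and> e \<inter> e' \<noteq> {}}. f e e') +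
      (\<Sum>e'\<in>{e' \<in> all_edges n. e \<inter> e' = {}}. f e e')" if e: "e \<in> all_edges n" for e
  proof -
    let ?C = "{e' \<in> all_edges n. e \<noteq> e' \<and> e \<inter> e' \<noteq> {}}" and ?D = "{e' \<in> all_edges n. e \<inter> e' = {}}"
    have "all_edges n = {e} \<union> (?C \<union> ?D)" using e by auto
    moreover have "sum (f e) ({e} \<union> (?C \<union> ?D)) = f e e + sum (f e) (?C \<union> ?D)"
      using all_edges_nonempty[OF e] by simp
    moreover have "sum (f e) (?C \<union> ?D) = sum (f e) ?C + sum (f e) ?D"
      by (rule sum.union_disjoint) auto
    ultimately show ?thesis by (simp add: add.assoc)
  qed
  then show ?thesis
    unfolding cherries_def disjoint_pairs_def
    by (simp add: sum.distrib sum.Sigma)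
qed

text \<open>Complementary counting of the edges that share exactly one vertex with a given edge; the
  value is \<open>2 * (n - 2)\<close> for \<open>n \<ge> 2\<close>.\<close>

definition cherry_degree :: "nat \<Rightarrow> real" where
  "cherry_degree n = real (n choose 2) - 1 - real ((n - 2) choose 2)"

lemma cherry_degree:
  assumes "e \<in> all_edges n"
  shows "real (card {f \<in> all_edges n. e \<noteq> f \<and> e \<inter> f \<noteq> {}}) = cherry_degree n"
proof -
  let ?C = "{e' \<in> all_edges n. e \<noteq> e' \<and> e \<inter> e' \<noteq> {}}" and ?D = "{e' \<in> all_edges n. e \<inter> e' = {}}"
  have "all_edges n = {e} \<union> (?C \<union> ?D)" using assms by auto
  then have "card (all_edges n) = card ({e} \<union> (?C \<union> ?D))" by simp
  also have "\<dots> = 1 + card (?C \<union> ?D)"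
    using all_edges_nonempty[OF assms] by simp
  also have "card (?C \<union> ?D) = card ?C + card ?D"
    by (rule card_Un_disjoint) auto
  finally show ?thesis
    unfolding cherry_degree_def card_all_edges card_disjoint_edges[OF assms] by simp
qed

section \<open>Closure properties of approximability by the edge count, and the sum over
  cherries\<close>

context random_graph
begin

lemma size_approximableI:
  assumes "\<And>n S. S \<subseteq> all_edges n \<Longrightarrow> Z n S = g n (card S) + R n S"
    and "\<And>n. expect n (\<lambda>S. (R n S)\<^sup>2) \<le> K * real n ^ r"
  shows "size_approximable r Z"
  unfolding size_approximable_def
proof (intro exI[of _ "max K 0"] conjI allI)
  fix n
  have "expect n (\<lambda>S. (Z n S - g n (card S))\<^sup>2) = expect n (\<lambda>S. (R n S)\<^sup>2)"
    by (rule expect_cong) (simp add: assms(1))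
  also have "\<dots> \<le> max K 0 * real n ^ r"
    by (rule order_trans[OF assms(2)]) (simp add: mult_right_mono)
  finally show "\<exists>h. expect n (\<lambda>S. (Z n S - h (card S))\<^sup>2) \<le> max K 0 * real n ^ r" by blast
qed simp

lemma size_approximableE:
  assumes "size_approximable r Z"
  obtains K h where "K \<ge> 0" "\<And>n. expect n (\<lambda>S. (Z n S - h n (card S))\<^sup>2) \<le> K * real n ^ r"
proof -
  obtain K where K: "K \<ge> 0" "\<forall>n. \<exists>h. expect n (\<lambda>S. (Z n S - h (card S))\<^sup>2) \<le> K * real n ^ r"
    using assms unfolding size_approximable_def by auto
  from choice[OF K(2)] obtain h where "\<forall>n. expect n (\<lambda>S. (Z n S - h n (card S))\<^sup>2) \<le> K * real n ^ r" ..
  then show ?thesis by (intro that[OF K(1)]) auto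
qed

lemma size_approximable_cmult:
  assumes "size_approximable r Z"
  shows "size_approximable r (\<lambda>n S. c * Z n S)"
proof -
  obtain K h where "K \<ge> 0" and h: "\<And>n. expect n (\<lambda>S. (Z n S - h n (card S))\<^sup>2) \<le> K * real n ^ r"
    by (rule size_approximableE[OF assms]) (rule that)
  show ?thesis
  proof (rule size_approximableI[where g = "\<lambda>n m. c * h n m" and R = "\<lambda>n S. c * (Z n S - h n (card S))" and K = "c\<^sup>2 * K"])
    show "expect n (\<lambda>S. (c * (Z n S - h n (card S)))\<^sup>2) \<le> c\<^sup>2 * K * real n ^ r" for n
      unfolding power_mult_distrib expect_cmult using h[of n] by (simp add: mult.assoc mult_left_mono)
  qed (simp add: algebra_simps)
qed

lemma size_approximable_add:
  assumes "size_approximable r Z" "size_approximable r Z'"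
  shows "size_approximable r (\<lambda>n S. Z n S + Z' n S)"
proof -
  obtain K h where "K \<ge> 0" and h: "\<And>n. expect n (\<lambda>S. (Z n S - h n (card S))\<^sup>2) \<le> K * real n ^ r"
    by (rule size_approximableE[OF assms(1)]) (rule that)
  obtain K' h' where "K' \<ge> 0" and h': "\<And>n. expect n (\<lambda>S. (Z' n S - h' n (card S))\<^sup>2) \<le> K' * real n ^ r"
    by (rule size_approximableE[OF assms(2)]) (rule that)
  let ?R = "\<lambda>n S. Z n S - h n (card S)" and ?R' = "\<lambda>n S. Z' n S - h' n (card S)"
  show ?thesis
  proof (rule size_approximableI[where g = "\<lambda>n m. h n m + h' n m" and R = "\<lambda>n S. ?R n S + ?R' n S" and K = "2 * K + 2 * K'"])
    fix n
    have "expect n (\<lambda>S. (?R n S + ?R' n S)\<^sup>2) \<le> expect n (\<lambda>S. 2 * (?R n S)\<^sup>2 + 2 * (?R' n S)\<^sup>2)"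
    proof (rule expect_mono)
      have "(a + b)\<^sup>2 \<le> 2 * a\<^sup>2 + 2 * b\<^sup>2" for a b :: real
        using sum_squares_bound[of a b] by (simp add: power2_sum)
      then show "(?R n S + ?R' n S)\<^sup>2 \<le> 2 * (?R n S)\<^sup>2 + 2 * (?R' n S)\<^sup>2" for S .
    qed
    also have "\<dots> = 2 * expect n (\<lambda>S. (?R n S)\<^sup>2) + 2 * expect n (\<lambda>S. (?R' n S)\<^sup>2)"
      by (simp only: expect_add expect_cmult)
    also have "\<dots> \<le> (2 * K + 2 * K') * real n ^ r"
      using h[of n] h'[of n] by (simp add: algebra_simps)
    finally show "expect n (\<lambda>S. (?R n S + ?R' n S)\<^sup>2) \<le> (2 * K + 2 * K') * real n ^ r" .
  qed simp
qed

lemma size_approximable_function: "size_approximable r (\<lambda>n S. g n (card S))"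
  by (rule size_approximableI[where R = "\<lambda>_ _. 0" and K = 0]) auto

lemma size_approximable_sum:
  assumes "finite I" "\<And>i. i \<in> I \<Longrightarrow> size_approximable r (Z i)"
  shows "size_approximable r (\<lambda>n S. \<Sum>i\<in>I. Z i n S)"
  using assms
proof (induction I rule: finite_induct)
  case empty
  then show ?case using size_approximable_function[of r "\<lambda>_ _. 0"] by simp
next
  case (insert i I)
  then show ?case by (simp add: size_approximable_add)
qed

lemma size_approximable_cong:
  assumes "size_approximable r Z" "\<And>n S. S \<subseteq> all_edges n \<Longrightarrow> Z' n S = Z n S"
  shows "size_approximable r Z'"
proof -
  obtain K h where "K \<ge> 0" and h: "\<And>n. expect n (\<lambda>S. (Z n S - h n (card S))\<^sup>2) \<le> K * real n ^ r"
    by (rule size_approximableE[OF assms(1)]) (rule that)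
  then show ?thesis
    by (intro size_approximableI[where g = h and R = "\<lambda>n S. Z n S - h n (card S)"]) (auto simp: assms(2))
qed

text \<open>Once the indicators are centred, this is the only part of the sum over cherries that the
  edge count does not determine.\<close>

definition cherry_sum :: "nat \<Rightarrow> nat set set \<Rightarrow> real" where
  "cherry_sum n S = (\<Sum>(e, f)\<in>cherries n. centred e S * centred f S)"

text \<open>A monomial with two edges arises from at most two ordered pairs, and there are at most
  \<open>n^3\<close> pairs.\<close>

lemma expect_cherry_sum_sq: "expect n (\<lambda>S. (cherry_sum n S)\<^sup>2) \<le> 2 * real n ^ 3"
proof -
  let ?\<Phi> = "\<lambda>(e, f). {e, f}"
  have "cherry_sum n S = (\<Sum>i\<in>cherries n. monomial (?\<Phi> i) S)" for S
    unfolding cherry_sum_def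
  proof (intro sum.cong refl)
    fix z assume "z \<in> cherries n"
    then obtain e f where "z = (e, f)" "e \<noteq> f" by (auto simp: cherries_def)
    then show "(case z of (e, f) \<Rightarrow> centred e S * centred f S) = monomial (?\<Phi> z) S"
      by (simp add: monomial_def)
  qed
  then have "expect n (\<lambda>S. (cherry_sum n S)\<^sup>2) = expect n (\<lambda>S. (\<Sum>i\<in>cherries n. monomial (?\<Phi> i) S)\<^sup>2)"
    by simp
  also have "\<dots> \<le> real (\<Sum>i\<in>cherries n. card {j \<in> cherries n. ?\<Phi> j = ?\<Phi> i})"
    by (rule expect_sum_monomials_le) (auto simp: cherries_def)
  also have "\<dots> \<le> real (\<Sum>i\<in>cherries n. 2)"
  proof (intro of_nat_mono sum_mono)
    fix i assume "i \<in> cherries n"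
    obtain e f where "i = (e, f)" by force
    then have "{j \<in> cherries n. ?\<Phi> j = ?\<Phi> i} \<subseteq> {(e, f), (f, e)}"
      by (auto simp: doubleton_eq_iff)
    then have "card {j \<in> cherries n. ?\<Phi> j = ?\<Phi> i} \<le> card {(e, f), (f, e)}" by (rule card_mono[rotated]) simp
    moreover have "card {(e, f), (f, e)} \<le> 2" by (cases "e = f") simp_all
    ultimately show "card {j \<in> cherries n. ?\<Phi> j = ?\<Phi> i} \<le> 2" by (rule order_trans)
  qed
  also have "\<dots> \<le> 2 * real n ^ 3"
    using card_cherries_le[of n] by (simp flip: of_nat_power)
  finally show ?thesis .
qed

text \<open>Every edge lies in equally many cherries. Because of this regularity the linear terms of
  a sum over cherries are multiples of the excess.\<close>

lemma sum_cherries_linear: "(\<Sum>(e, f)\<in>cherries n. u e) = cherry_degree n * (\<Sum>e\<in>all_edges n. u e)"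
  "(\<Sum>(e, f)\<in>cherries n. u f) = cherry_degree n * (\<Sum>e\<in>all_edges n. u e)"
proof -
  show *: "(\<Sum>(e, f)\<in>cherries n. u e) = cherry_degree n * (\<Sum>e\<in>all_edges n. u e)"
  proof -
    have "(\<Sum>(e, f)\<in>cherries n. u e) = (\<Sum>e\<in>all_edges n. \<Sum>f\<in>{f \<in> all_edges n. e \<noteq> f \<and> e \<inter> f \<noteq> {}}. u e)"
      unfolding cherries_def by (rule sum.Sigma[symmetric]) auto
    also have "\<dots> = (\<Sum>e\<in>all_edges n. cherry_degree n * u e)"
      by (intro sum.cong refl) (simp add: cherry_degree)
    finally show ?thesis by (simp add: sum_distrib_left)
  qed
  have "(\<Sum>(e, f)\<in>cherries n. u f) = (\<Sum>(e, f)\<in>cherries n. u e)"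
    by (rule sum.reindex_bij_witness[where i = prod.swap and j = prod.swap]) (auto simp: cherries_def)
  then show "(\<Sum>(e, f)\<in>cherries n. u f) = cherry_degree n * (\<Sum>e\<in>all_edges n. u e)" using * by simp
qed

text \<open>Pairs of equal edges and cherries are subtracted from the square of the edge count, and
  each indicator in a cherry is written as its centred version plus \<open>p\<close>.\<close>

lemma sum_disjoint_pairs_eq:
  assumes "S \<subseteq> all_edges n"
  shows "(\<Sum>(e, f)\<in>disjoint_pairs n. of_bool (e \<in> S) * of_bool (f \<in> S)) =
    (real (card S))\<^sup>2 - real (card S) - (2 * p * cherry_degree n * excess n S + p\<^sup>2 * real (card (cherries n)))
    - cherry_sum n S"
proof -
  let ?A = "all_edges n"
  let ?i = "\<lambda>e. of_bool (e \<in> S) :: real"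
  have m: "(\<Sum>e\<in>?A. ?i e) = real (card S)"
    using assms by (simp add: sum_of_bool_eq Int_absorb1)
  have "(real (card S))\<^sup>2 = (\<Sum>e\<in>?A. \<Sum>f\<in>?A. ?i e * ?i f)"
    unfolding m[symmetric] power2_eq_square sum_product ..
  also have "\<dots> = (\<Sum>e\<in>?A. ?i e) + (\<Sum>(e, f)\<in>cherries n. ?i e * ?i f) + (\<Sum>(e, f)\<in>disjoint_pairs n. ?i e * ?i f)"
    unfolding sum_edge_pairs by simp
  also have "(\<Sum>(e, f)\<in>cherries n. ?i e * ?i f) =
    (\<Sum>(e, f)\<in>cherries n. centred e S * centred f S + p * centred e S + p * centred f S + p\<^sup>2)"
    by (intro sum.cong refl) (auto simp: centred_def algebra_simps power2_eq_square)
  also have "\<dots> = cherry_sum n S + p * (\<Sum>(e, f)\<in>cherries n. centred e S) + p * (\<Sum>(e, f)\<in>cherries n. centred f S)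
    + p\<^sup>2 * real (card (cherries n))"
    by (simp add: split_def sum.distrib sum_distrib_left cherry_sum_def)
  also have "\<dots> = cherry_sum n S + 2 * p * cherry_degree n * excess n S + p\<^sup>2 * real (card (cherries n))"
    by (simp add: sum_cherries_linear excess_def)
  finally show ?thesis unfolding m by simp
qed

text \<open>Both indicators are expanded around \<open>p\<close>. By orthogonality only the two
  terms of degree one correlate with the excess, and each contributes
  \<open>p * (p * (1 - p))\<close>.\<close>

lemma expect_disjoint_pair_excess:
  assumes "(e, f) \<in> disjoint_pairs n"
  shows "expect n (\<lambda>S. of_bool (e \<in> S) * of_bool (f \<in> S) * excess n S) = 2 * p * (p * (1 - p))"
proof -
  have ef: "e \<in> all_edges n" "f \<in> all_edges n" "e \<noteq> f"
    using assms all_edges_nonempty by (auto simp: disjoint_pairs_def)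
  have single: "expect n (\<lambda>S. centred x S * excess n S) = p * (1 - p)" if x: "x \<in> all_edges n" for x
  proof -
    have "expect n (\<lambda>S. centred x S * excess n S) = (\<Sum>g\<in>all_edges n. expect n (\<lambda>S. monomial {x} S * monomial {g} S))"
      unfolding excess_def sum_distrib_left expect_sum by simp
    also have "\<dots> = (\<Sum>g\<in>all_edges n. if x = g then p * (1 - p) else 0)"
      using x by (intro sum.cong refl, subst expect_monomial_mult) auto
    finally show ?thesis using x by simp
  qed
  have double: "expect n (\<lambda>S. monomial {e, f} S * excess n S) = 0"
  proof -
    have "expect n (\<lambda>S. monomial {e, f} S * excess n S) = (\<Sum>g\<in>all_edges n. expect n (\<lambda>S. monomial {e, f} S * monomial {g} S))"
      unfolding excess_def sum_distrib_left expect_sum by simp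
    also have "\<dots> = (\<Sum>g\<in>all_edges n. 0)"
      using ef by (intro sum.cong refl, subst expect_monomial_mult) auto
    finally show ?thesis by simp
  qed
  have "expect n (\<lambda>S. of_bool (e \<in> S) * of_bool (f \<in> S) * excess n S) =
    expect n (\<lambda>S. monomial {e, f} S * excess n S + p * (centred e S * excess n S) + p * (centred f S * excess n S) + p\<^sup>2 * excess n S)"
    by (rule expect_cong) (use ef in \<open>simp add: monomial_def centred_def algebra_simps power2_eq_square\<close>)
  also have "\<dots> = 2 * p * (p * (1 - p))"
    by (simp only: expect_add expect_cmult double single ef expect_excess)
  finally show ?thesis .
qed

end

section \<open>Copies of two disjoint edges as pairs of edges\<close>

lemma graph_iso_two_K2_iff:
  assumes S: "S \<subseteq> all_edges n"
  shows "V' \<subseteq> {..<n} \<and> E' \<subseteq> S \<and> (\<forall>e\<in>E'. e \<subseteq> V') \<and> graph_iso V' E' two_K2_V two_K2_E \<longleftrightarrow>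
    (\<exists>e\<in>S. \<exists>f\<in>S. e \<inter> f = {} \<and> V' = e \<union> f \<and> E' = {e, f})"
proof (intro iffI)
  assume "V' \<subseteq> {..<n} \<and> E' \<subseteq> S \<and> (\<forall>e\<in>E'. e \<subseteq> V') \<and> graph_iso V' E' two_K2_V two_K2_E"
  then have V': "V' \<subseteq> {..<n}" and E': "E' \<subseteq> S" "\<forall>e\<in>E'. e \<subseteq> V'"
    and gi: "graph_iso V' E' two_K2_V two_K2_E" by simp_all
  from gi obtain h where hh: "bij_betw h V' two_K2_V \<and>
      (\<forall>u\<in>V'. \<forall>v\<in>V'. {u, v} \<in> E' \<longleftrightarrow> {h u, h v} \<in> two_K2_E)"
    unfolding graph_iso_def ..
  then have h: "bij_betw h V' {0, 1, 2, 3::nat}"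
    and iso: "\<And>u v. u \<in> V' \<Longrightarrow> v \<in> V' \<Longrightarrow> {u, v} \<in> E' \<longleftrightarrow> {h u, h v} \<in> {{0, 1}, {2, 3}}"
    unfolding two_K2_V_def two_K2_E_def by simp_all
  have img: "h ` V' = {0, 1, 2, 3}" using h by (simp add: bij_betw_def)
  have "0 \<in> h ` V'" "1 \<in> h ` V'" "2 \<in> h ` V'" "3 \<in> h ` V'" unfolding img by simp_all
  then obtain a b c d where V: "a \<in> V'" "b \<in> V'" "c \<in> V'" "d \<in> V'"
    and hv: "h a = 0" "h b = 1" "h c = 2" "h d = 3"
    by (elim imageE) (simp add: that)
  have inj: "x = y" if "x \<in> V'" "y \<in> V'" "h x = h y" for x y
    using h that by (auto simp: bij_betw_def inj_on_def)
  have V'_eq: "V' = {a, b, c, d}"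
  proof
    show "V' \<subseteq> {a, b, c, d}"
    proof
      fix x assume x: "x \<in> V'"
      then have "h x \<in> {0, 1, 2, 3}" unfolding img[symmetric] by simp
      then show "x \<in> {a, b, c, d}" using inj[OF x] V hv by auto
    qed
  qed (use V in auto)
  have ab: "{a, b} \<in> E'" "{c, d} \<in> E'" using iso V hv by auto
  have "e \<in> {{a, b}, {c, d}}" if e: "e \<in> E'" for e
  proof -
    obtain u v where uv: "e = {u, v}" using e E' S by (auto simp: all_edges_def)
    moreover have "u \<in> V'" "v \<in> V'" using E'(2) e uv by auto
    ultimately have *: "{h u, h v} \<in> {{0, 1}, {2, 3}}" "u \<in> {a, b, c, d}" "v \<in> {a, b, c, d}"
      using iso e V'_eq by auto
    then show ?thesis using hv unfolding uv by (auto simp: doubleton_eq_iff)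
  qed
  then have "E' = {{a, b}, {c, d}}" using ab by auto
  moreover have "{a, b} \<inter> {c, d} = {}" using hv by auto
  ultimately show "\<exists>e\<in>S. \<exists>f\<in>S. e \<inter> f = {} \<and> V' = e \<union> f \<and> E' = {e, f}"
    using ab E' V'_eq by (intro bexI[of _ "{a, b}"] bexI[of _ "{c, d}"]) auto
next
  assume "\<exists>e\<in>S. \<exists>f\<in>S. e \<inter> f = {} \<and> V' = e \<union> f \<and> E' = {e, f}"
  then obtain e f where ef: "e \<in> S" "f \<in> S" "e \<inter> f = {}" "V' = e \<union> f" "E' = {e, f}" by blast
  obtain a b where e: "e = {a, b}" "a \<noteq> b" "a < n" "b < n" using ef(1) S by (auto simp: all_edges_def)
  obtain c d where f: "f = {c, d}" "c \<noteq> d" "c < n" "d < n" using ef(2) S by (auto simp: all_edges_def)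
  have neq: "a \<noteq> c" "a \<noteq> d" "b \<noteq> c" "b \<noteq> d" using ef(3) e f by auto
  let ?h = "\<lambda>x. if x = a then 0 else if x = b then 1 else if x = c then 2 else 3 :: nat"
  have bij: "bij_betw ?h V' {0, 1, 2, 3}"
    using neq e f ef(4) by (auto simp: bij_betw_def inj_on_def)
  have pres: "{u, v} \<in> E' \<longleftrightarrow> {?h u, ?h v} \<in> {{0, 1}, {2, 3}}" if "u \<in> V'" "v \<in> V'" for u v
  proof -
    have u: "u = a \<or> u = b \<or> u = c \<or> u = d" and v: "v = a \<or> v = b \<or> v = c \<or> v = d"
      using that e(1) f(1) unfolding ef(4) by auto
    show ?thesis
      unfolding ef(5) e(1) f(1)
      by (rule disjE[OF u]; (elim disjE)?; rule disjE[OF v]; (elim disjE)?;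
          simp add: doubleton_eq_iff neq neq[symmetric] e(2) e(2)[symmetric] f(2) f(2)[symmetric])
  qed
  have "graph_iso V' E' two_K2_V two_K2_E"
    unfolding graph_iso_def two_K2_V_def two_K2_E_def
    by (intro exI[of _ ?h] conjI ballI bij) (rule pres)
  then show "V' \<subseteq> {..<n} \<and> E' \<subseteq> S \<and> (\<forall>e\<in>E'. e \<subseteq> V') \<and> graph_iso V' E' two_K2_V two_K2_E"
    using ef e f by auto
qed

text \<open>The map from ordered disjoint pairs of edges to copies is two-to-one, since exchanging
  the two edges gives the same copy.\<close>

lemma sub_count_two_K2:
  assumes S: "S \<subseteq> all_edges n"
  shows "2 * real (sub_count two_K2_V two_K2_E n S) =
    (\<Sum>(e, f)\<in>disjoint_pairs n. of_bool (e \<in> S) * of_bool (f \<in> S))"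
proof -
  let ?P = "{(e, f). e \<in> S \<and> f \<in> S \<and> e \<inter> f = {}}"
  let ?g = "\<lambda>(e, f). (e \<union> f, {e, f})"
  have finS: "finite S" using S finite_subset by auto
  have finP: "finite ?P" by (rule finite_subset[of _ "S \<times> S"]) (use finS in auto)
  have "{(V', E'). V' \<subseteq> {..<n} \<and> E' \<subseteq> S \<and> (\<forall>e\<in>E'. e \<subseteq> V') \<and> graph_iso V' E' two_K2_V two_K2_E} = ?g ` ?P"
    (is "?L = _")
  proof (rule set_eqI)
    fix z :: "nat set \<times> nat set set"
    obtain V' E' where z: "z = (V', E')" by (cases z)
    have "z \<in> ?L \<longleftrightarrow> (\<exists>e\<in>S. \<exists>f\<in>S. e \<inter> f = {} \<and> V' = e \<union> f \<and> E' = {e, f})"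
      unfolding z mem_Collect_eq prod.case by (rule graph_iso_two_K2_iff[OF S])
    also have "\<dots> \<longleftrightarrow> z \<in> ?g ` ?P"
    proof
      assume "\<exists>e\<in>S. \<exists>f\<in>S. e \<inter> f = {} \<and> V' = e \<union> f \<and> E' = {e, f}"
      then obtain e f where "(e, f) \<in> ?P" "z = ?g (e, f)" unfolding z by auto
      then show "z \<in> ?g ` ?P" by (rule image_eqI[rotated])
    next
      assume "z \<in> ?g ` ?P"
      then obtain x where x: "z = ?g x" "x \<in> ?P" by (rule imageE)
      obtain e f where "x = (e, f)" by (cases x)
      with x have "(e, f) \<in> ?P" "z = ?g (e, f)" by simp_all
      then show "\<exists>e\<in>S. \<exists>f\<in>S. e \<inter> f = {} \<and> V' = e \<union> f \<and> E' = {e, f}" unfolding z by auto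
    qed
    finally show "z \<in> ?L \<longleftrightarrow> z \<in> ?g ` ?P" .
  qed
  then have sub: "sub_count two_K2_V two_K2_E n S = card (?g ` ?P)"
    unfolding sub_count_def by simp
  have "card ?P = (\<Sum>z\<in>?g ` ?P. card {x \<in> ?P. ?g x = z})"
    using sum.image_gen[OF finP, of "\<lambda>_. 1::nat" ?g] by simp
  also have "\<dots> = (\<Sum>z\<in>?g ` ?P. 2)"
  proof (rule sum.cong)
    fix z assume "z \<in> ?g ` ?P"
    then obtain e f where ef: "e \<in> S" "f \<in> S" "e \<inter> f = {}" "z = (e \<union> f, {e, f})" by auto
    then have "e \<noteq> f" using S all_edges_nonempty by auto
    moreover have "{x \<in> ?P. ?g x = z} = {(e, f), (f, e)}"
      using ef by (auto simp: doubleton_eq_iff)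
    ultimately show "card {x \<in> ?P. ?g x = z} = 2" by simp
  qed simp
  finally have "card ?P = 2 * sub_count two_K2_V two_K2_E n S" using sub by simp
  moreover have "(\<Sum>(e, f)\<in>disjoint_pairs n. of_bool (e \<in> S) * of_bool (f \<in> S)) = real (card ?P)"
  proof -
    have "(\<Sum>(e, f)\<in>disjoint_pairs n. of_bool (e \<in> S) * of_bool (f \<in> S)) = (\<Sum>x\<in>disjoint_pairs n. of_bool (x \<in> ?P) :: real)"
      by (intro sum.cong refl) (auto simp: disjoint_pairs_def)
    also have "\<dots> = real (card (disjoint_pairs n \<inter> ?P))" by (simp add: sum_of_bool_eq)
    also have "disjoint_pairs n \<inter> ?P = ?P" using S by (auto simp: disjoint_pairs_def)
    finally show ?thesis .
  qed
  ultimately show ?thesis by simp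
qed

text \<open>Here \<open>d = 3\<close>: the remainder is minus one half of \<open>cherry_sum\<close>,
  whose second moment is of order at most \<open>n^3\<close>, and the covariance with the edge count
  is of order \<open>n^4\<close>.\<close>

lemma (in random_graph) two_K2_anticoncentration_failure:
  "\<exists>c>0. \<forall>\<^sub>F n in sequentially.
    c * sqrt (real n) / std_dev (gnp n p) (\<lambda>E. real (sub_count two_K2_V two_K2_E n E))
    \<le> max_point_prob (gnp n p) (\<lambda>E. real (sub_count two_K2_V two_K2_E n E))"
proof (rule anticoncentration_failure[where d = 3 and a = "p * (p * (1 - p)) / 32"])
  let ?X = "\<lambda>n S. real (sub_count two_K2_V two_K2_E n S)"
  let ?g = "\<lambda>n m. ((real m)\<^sup>2 - real m - (2 * p * cherry_degree n * (real m - real (card (all_edges n)) * p) +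
    p\<^sup>2 * real (card (cherries n)))) / 2"
  have "size_approximable 3 ?X"
  proof (rule size_approximableI[where g = ?g and R = "\<lambda>n S. - (1 / 2) * cherry_sum n S" and K = "1 / 2"])
    show "?X n S = ?g n (card S) + - (1 / 2) * cherry_sum n S" if "S \<subseteq> all_edges n" for n S
      using sub_count_two_K2[OF that] unfolding sum_disjoint_pairs_eq[OF that] excess_eq[OF that]
      by (simp add: field_simps)
    show "expect n (\<lambda>S. (- (1 / 2) * cherry_sum n S)\<^sup>2) \<le> 1 / 2 * real n ^ 3" for n
      unfolding power_mult_distrib expect_cmult using expect_cherry_sum_sq[of n] by (simp add: power2_eq_square)
  qed
  then show "size_approximable (2 * 3 - 3) ?X" by simp
  show "\<forall>\<^sub>F n in sequentially. p * (p * (1 - p)) / 32 * real n ^ (3 + 1) \<le> \<bar>expect n (\<lambda>S. ?X n S * excess n S)\<bar>"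
    using eventually_ge_at_top[of 6]
  proof eventually_elim
    case (elim n)
    have "expect n (\<lambda>S. ?X n S * excess n S) =
      expect n (\<lambda>S. 1 / 2 * (\<Sum>x\<in>disjoint_pairs n. of_bool (fst x \<in> S) * of_bool (snd x \<in> S) * excess n S))"
    proof (rule expect_cong)
      fix S assume "S \<subseteq> all_edges n"
      from sub_count_two_K2[OF this]
      show "?X n S * excess n S = 1 / 2 * (\<Sum>x\<in>disjoint_pairs n. of_bool (fst x \<in> S) * of_bool (snd x \<in> S) * excess n S)"
        unfolding split_def sum_distrib_right[symmetric] by simp
    qed
    also have "\<dots> = 1 / 2 * (\<Sum>x\<in>disjoint_pairs n. 2 * p * (p * (1 - p)))"
      unfolding expect_cmult expect_sum
      by (intro arg_cong2[where f = "(*)"] refl sum.cong) (simp add: expect_disjoint_pair_excess)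
    also have "\<dots> = p * (p * (1 - p)) * (real (n choose 2) * real ((n - 2) choose 2))"
      unfolding disjoint_pairs_def by (simp add: card_SigmaI card_disjoint_edges card_all_edges)
    finally have eq: "expect n (\<lambda>S. ?X n S * excess n S) = p * (p * (1 - p)) * (real (n choose 2) * real ((n - 2) choose 2))" .
    \<comment> \<open>The two factors 1/4 and 1/8 give the 1/32 in \<open>a\<close>. The condition
      \<open>n \<ge> 6\<close> is the one that makes \<open>n - 3\<close> at least
      \<open>n / 2\<close>.\<close>
    have "real n ^ 2 / 4 \<le> real (n choose 2)"
      using elim by (simp add: choose_two real_of_nat_div of_nat_diff power2_eq_square field_simps)
    moreover have "real n ^ 2 / 8 \<le> real ((n - 2) choose 2)"
    proof -
      have "(real n / 2) * (real n / 2) \<le> (real n - 2) * (real n - 3)"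
        using elim by (intro mult_mono) auto
      also have "\<dots> = 2 * real ((n - 2) choose 2)"
        using elim by (simp add: choose_two real_of_nat_div of_nat_diff)
      finally show ?thesis by (simp add: power2_eq_square)
    qed
    ultimately have "(real n ^ 2 / 4) * (real n ^ 2 / 8) \<le> real (n choose 2) * real ((n - 2) choose 2)"
      by (intro mult_mono) auto
    then have "real n ^ 4 / 32 \<le> real (n choose 2) * real ((n - 2) choose 2)" by (simp flip: power_add)
    then have "p * (p * (1 - p)) * (real n ^ 4 / 32) \<le> p * (p * (1 - p)) * (real (n choose 2) * real ((n - 2) choose 2))"
      using p_pos p_less_1 by (intro mult_left_mono) auto
    also have "\<dots> \<le> \<bar>expect n (\<lambda>S. ?X n S * excess n S)\<bar>" unfolding eq by (rule abs_ge_self)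
    finally show ?case by simp
  qed
qed (use p_pos p_less_1 in auto)

section \<open>Sums over injections\<close>

text \<open>An injection is the list of its values: composition with a permutation becomes
  \<open>map ((!) xs) \<pi>\<close>, and restriction to an initial segment becomes
  \<open>take\<close>. In particular \<open>injections k k\<close> is the symmetric group.\<close>

definition injections :: "nat \<Rightarrow> nat \<Rightarrow> nat list set" where
  "injections k n = {xs. length xs = k \<and> distinct xs \<and> set xs \<subseteq> {..<n}}"

lemma finite_injections [simp, intro]: "finite (injections k n)"
proof (rule finite_subset)
  show "injections k n \<subseteq> {xs. set xs \<subseteq> {..<n} \<and> length xs = k}"
    by (auto simp: injections_def)
  show "finite {xs. set xs \<subseteq> {..<n} \<and> length xs = k}"
    by (rule finite_lists_length_eq) simp
qed

lemma sum_permutations_of_set: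
  fixes f :: "'a list \<Rightarrow> 'b::comm_monoid_add"
  assumes "finite S" "S \<noteq> {}"
  shows "(\<Sum>xs\<in>permutations_of_set S. f xs) =
         (\<Sum>x\<in>S. \<Sum>xs\<in>permutations_of_set (S - {x}). f (x # xs))"
proof -
  have "(\<Sum>xs\<in>permutations_of_set S. f xs) =
        (\<Sum>xs\<in>(\<Union>x\<in>S. (#) x ` permutations_of_set (S - {x})). f xs)"
    by (subst permutations_of_set_nonempty[OF assms(2)]) simp
  also have "\<dots> = (\<Sum>x\<in>S. \<Sum>xs\<in>(#) x ` permutations_of_set (S - {x}). f xs)"
    by (rule sum.UNION_disjoint) (use assms in auto)
  also have "\<dots> = (\<Sum>x\<in>S. \<Sum>xs\<in>permutations_of_set (S - {x}). f (x # xs))"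
    by (rule sum.cong) (auto simp: sum.reindex)
  finally show ?thesis .
qed

lemma sum_injections_subsets:
  fixes f :: "nat list \<Rightarrow> 'b::comm_monoid_add"
  shows "(\<Sum>xs\<in>injections k n. f xs) =
         (\<Sum>S\<in>{S. S \<subseteq> {..<n} \<and> card S = k}. \<Sum>xs\<in>permutations_of_set S. f xs)"
proof -
  have eq: "injections k n = (\<Union>S\<in>{S. S \<subseteq> {..<n} \<and> card S = k}. permutations_of_set S)"
    by (auto simp: injections_def permutations_of_set_def distinct_card)
  have fin: "finite {S. S \<subseteq> {..<n} \<and> card S = k}"
    by (rule finite_subset[of _ "Pow {..<n}"]) auto
  show ?thesis unfolding eq
  proof (rule sum.UNION_disjoint[OF fin])
    show "\<forall>S\<in>{S. S \<subseteq> {..<n} \<and> card S = k}. finite (permutations_of_set S)" by simp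
  qed (auto simp: permutations_of_set_def)
qed

text \<open>Splitting off the least element repeatedly leads to nested sums over increasing tuples,
  the order in which the patterns are counted later.\<close>

lemma sum_card_subsets_Suc:
  fixes g :: "nat set \<Rightarrow> 'b::comm_monoid_add"
  shows "(\<Sum>S\<in>{S. S \<subseteq> {i..<n} \<and> card S = Suc k}. g S) =
         (\<Sum>a=i..<n. \<Sum>S\<in>{S. S \<subseteq> {Suc a..<n} \<and> card S = k}. g (insert a S))"
proof -
  have fin: "finite {S. S \<subseteq> {j..<n} \<and> card S = l}" for j l
    by (rule finite_subset[of _ "Pow {j..<n}"]) auto
  have Min_insert: "Min (insert a S) = a" if "S \<subseteq> {Suc a..<n}" for a S
  proof (rule Min_eqI)
    show "finite (insert a S)" using that finite_subset by auto
  qed (use that in auto)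
  have "(\<Sum>a=i..<n. \<Sum>S\<in>{S. S \<subseteq> {Suc a..<n} \<and> card S = k}. g (insert a S)) =
        (\<Sum>(a, S)\<in>(SIGMA a:{i..<n}. {S. S \<subseteq> {Suc a..<n} \<and> card S = k}). g (insert a S))"
    by (rule sum.Sigma) (auto simp: fin)
  also have "\<dots> = (\<Sum>S\<in>{S. S \<subseteq> {i..<n} \<and> card S = Suc k}. g S)"
  proof (rule sum.reindex_bij_witness[where i = "\<lambda>S. (Min S, S - {Min S})" and j = "\<lambda>(a, S). insert a S"],
         goal_cases)
    case (1 p)
    then obtain a S where p: "p = (a, S)" "S \<subseteq> {Suc a..<n}" by auto
    then show ?case using Min_insert[of S a] by auto
  next
    case (2 p)
    then obtain a S where p: "p = (a, S)" "S \<subseteq> {Suc a..<n}" "i \<le> a" "a < n" "card S = k" by auto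
    moreover have "finite S" "a \<notin> S" using p finite_subset by auto
    ultimately show ?case by auto
  next
    case (3 S)
    then have "finite S" "S \<noteq> {}" using finite_subset by auto
    then show ?case by (auto simp: insert_absorb)
  next
    case (4 S)
    then have S: "finite S" "S \<noteq> {}" "S \<subseteq> {i..<n}" using finite_subset by auto
    then have "Min S \<in> S" by simp
    moreover have "Suc (Min S) \<le> x" if "x \<in> S - {Min S}" for x
      using S that by (simp add: Suc_le_eq order.strict_iff_order)
    moreover have "card (S - {Min S}) = k" using 4 S by (simp add: card_Diff_singleton)
    ultimately show ?case using S by fastforce
  next
    case (5 p)
    then show ?case by auto
  qed
  finally show ?thesis by simp
qed

lemma sum_card_subsets_0:
  fixes g :: "nat set \<Rightarrow> 'b::comm_monoid_add"
  shows "(\<Sum>S\<in>{S. S \<subseteq> {i..<n} \<and> card S = 0}. g S) = g {}"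
proof -
  have "{S. S \<subseteq> {i..<n} \<and> card S = 0} = {{}}"
    by (auto simp: card_eq_0_iff dest: finite_subset)
  then show ?thesis by simp
qed

abbreviation sum_quadruples :: "nat \<Rightarrow> (nat \<Rightarrow> nat \<Rightarrow> nat \<Rightarrow> nat \<Rightarrow> 'b) \<Rightarrow> 'b::comm_monoid_add" where
  "sum_quadruples n f \<equiv> (\<Sum>a=0..<n. \<Sum>b=Suc a..<n. \<Sum>c=Suc b..<n. \<Sum>d=Suc c..<n. f a b c d)"

lemma sum_permutations_of_2:
  fixes f :: "'a list \<Rightarrow> 'b::comm_monoid_add"
  assumes "a \<noteq> b"
  shows "(\<Sum>xs\<in>permutations_of_set {a, b}. f xs) = f [a, b] + f [b, a]"
proof -
  have "{a, b} - {a} = {b}" "{a, b} - {b} = {a}" using assms by auto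
  then show ?thesis using assms by (simp add: sum_permutations_of_set[of "{a, b}"])
qed

lemma sum_permutations_of_3:
  fixes f :: "'a list \<Rightarrow> 'b::comm_monoid_add"
  assumes "a \<noteq> b" "a \<noteq> c" "b \<noteq> c"
  shows "(\<Sum>xs\<in>permutations_of_set {a, b, c}. f xs) =
    f [a, b, c] + f [a, c, b] + f [b, a, c] + f [b, c, a] + f [c, a, b] + f [c, b, a]"
proof -
  have diff: "{a, b, c} - {a} = {b, c}" "{a, b, c} - {b} = {a, c}" "{a, b, c} - {c} = {a, b}"
    using assms by auto
  have sum3: "sum g {a, b, c} = g a + g b + g c" for g :: "'a \<Rightarrow> 'b"
    using assms by (simp add: add.assoc)
  show ?thesis
    unfolding sum_permutations_of_set[of "{a, b, c}", simplified] sum3 diff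
    using assms by (simp only: sum_permutations_of_2 add.assoc not_False_eq_True simp_thms)
qed

lemma sum_permutations_of_4:
  fixes f :: "'a list \<Rightarrow> 'b::comm_monoid_add"
  assumes "distinct [a, b, c, d]"
  shows "(\<Sum>xs\<in>permutations_of_set {a, b, c, d}. f xs) =
    f [a, b, c, d] + f [a, b, d, c] + f [a, c, b, d] + f [a, c, d, b] + f [a, d, b, c] + f [a, d, c, b] +
    f [b, a, c, d] + f [b, a, d, c] + f [b, c, a, d] + f [b, c, d, a] + f [b, d, a, c] + f [b, d, c, a] +
    f [c, a, b, d] + f [c, a, d, b] + f [c, b, a, d] + f [c, b, d, a] + f [c, d, a, b] + f [c, d, b, a] +
    f [d, a, b, c] + f [d, a, c, b] + f [d, b, a, c] + f [d, b, c, a] + f [d, c, a, b] + f [d, c, b, a]"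
proof -
  have neq: "a \<noteq> b" "a \<noteq> c" "a \<noteq> d" "b \<noteq> c" "b \<noteq> d" "c \<noteq> d"
    using assms by auto
  have diff: "{a, b, c, d} - {a} = {b, c, d}" "{a, b, c, d} - {b} = {a, c, d}"
    "{a, b, c, d} - {c} = {a, b, d}" "{a, b, c, d} - {d} = {a, b, c}"
    using neq by auto
  have sum4: "sum g {a, b, c, d} = g a + g b + g c + g d" for g :: "'a \<Rightarrow> 'b"
    using neq by (simp add: add.assoc)
  show ?thesis
    unfolding sum_permutations_of_set[of "{a, b, c, d}", simplified] sum4 diff
    using neq by (simp only: sum_permutations_of_3 not_False_eq_True simp_thms not_sym add.assoc)
qed

lemma sum_injections_4:
  fixes f :: "nat list \<Rightarrow> 'b::comm_monoid_add"
  shows "(\<Sum>xs\<in>injections 4 n. f xs) = sum_quadruples n (\<lambda>a b c d.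
    \<Sum>xs\<in>permutations_of_set {a, b, c, d}. f xs)"
proof -
  have "(\<Sum>xs\<in>injections 4 n. f xs) =
    (\<Sum>S\<in>{S. S \<subseteq> {0..<n} \<and> card S = Suc (Suc (Suc (Suc 0)))}. \<Sum>xs\<in>permutations_of_set S. f xs)"
    unfolding sum_injections_subsets by (simp add: atLeast0LessThan numeral_eq_Suc)
  then show ?thesis
    by (simp only: sum_card_subsets_Suc sum_card_subsets_0)
qed

section \<open>Relabelling of edge sets and changes of variables in sums over injections\<close>

definition relabel :: "nat list \<Rightarrow> nat set set \<Rightarrow> nat set set" where
  "relabel xs F = (`) ((!) xs) ` F"

lemma injections_nth_less: "xs \<in> injections k n \<Longrightarrow> i < k \<Longrightarrow> xs ! i < n"
  by (simp add: injections_def) (metis lessThan_iff nth_mem subsetD)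

lemma injections_inj_on: "xs \<in> injections k n \<Longrightarrow> inj_on ((!) xs) {..<k}"
  by (auto simp: injections_def intro: inj_on_nth)

lemma injections_image_all_edges:
  assumes "xs \<in> injections k n" "e \<in> all_edges k"
  shows "(!) xs ` e \<in> all_edges n"
proof -
  obtain i j where "i < k" "j < k" "i \<noteq> j" "e = {i, j}" using assms(2) by (auto simp: all_edges_def)
  moreover have "xs ! i \<noteq> xs ! j"
    using assms(1) calculation by (auto simp: injections_def nth_eq_iff_index_eq)
  ultimately show ?thesis using injections_nth_less[OF assms(1)] by (auto intro: all_edgesI)
qed

lemma inj_on_image_all_edges: "xs \<in> injections k n \<Longrightarrow> inj_on ((`) ((!) xs)) (all_edges k)"
  by (rule inj_on_subset[OF inj_on_image_Pow[OF injections_inj_on]]) (auto simp: all_edges_altdef)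

lemma relabel_subset: "xs \<in> injections k n \<Longrightarrow> F \<subseteq> all_edges k \<Longrightarrow> relabel xs F \<subseteq> all_edges n"
  by (auto simp: relabel_def intro: injections_image_all_edges)

lemma prod_relabel:
  fixes g :: "nat set \<Rightarrow> 'a::comm_monoid_mult"
  assumes "xs \<in> injections k n" "F \<subseteq> all_edges k"
  shows "prod g (relabel xs F) = (\<Prod>e\<in>F. g ((!) xs ` e))"
  unfolding relabel_def
  by (subst prod.reindex[OF inj_on_subset[OF inj_on_image_all_edges[OF assms(1)] assms(2)]]) simp

lemma card_relabel:
  assumes "xs \<in> injections k n" "F \<subseteq> all_edges k"
  shows "card (relabel xs F) = card F"
  unfolding relabel_def
  by (rule card_image[OF inj_on_subset[OF inj_on_image_all_edges[OF assms(1)] assms(2)]])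

lemma map_nth_injections:
  assumes "xs \<in> injections k n" "\<pi> \<in> injections j k"
  shows "map ((!) xs) \<pi> \<in> injections j n"
proof -
  have "inj_on ((!) xs) (set \<pi>)"
    by (rule inj_on_subset[OF injections_inj_on[OF assms(1)]]) (use assms in \<open>auto simp: injections_def\<close>)
  then show ?thesis
    using assms injections_nth_less[OF assms(1)] by (auto simp: injections_def distinct_map)
qed

lemma nth_map_image:
  assumes "\<pi> \<in> injections j k" "e \<in> all_edges j"
  shows "(!) (map ((!) xs) \<pi>) ` e = (!) xs ` (!) \<pi> ` e"
  using assms by (auto simp: all_edges_def injections_def)

lemma relabel_map:
  assumes "\<pi> \<in> injections j k" "F \<subseteq> all_edges j"
  shows "relabel (map ((!) xs) \<pi>) F = relabel xs (relabel \<pi> F)"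
  unfolding relabel_def image_comp comp_def
  by (rule image_cong[OF refl], rule nth_map_image[OF assms(1), unfolded image_comp comp_def])
    (use assms in auto)

lemma set_permutation: "\<pi> \<in> injections k k \<Longrightarrow> set \<pi> = {..<k}"
  by (rule card_subset_eq) (auto simp: injections_def distinct_card)

text \<open>An injective self-map of a finite set is surjective. This allows composing the summation
  variable with a permutation.\<close>

lemma bij_betw_map_nth:
  assumes "\<pi> \<in> injections k k"
  shows "bij_betw (\<lambda>xs. map ((!) xs) \<pi>) (injections k n) (injections k n)"
proof -
  have "inj_on (\<lambda>xs. map ((!) xs) \<pi>) (injections k n)"
  proof (rule inj_onI)
    fix xs ys assume xs: "xs \<in> injections k n" "ys \<in> injections k n" and eq: "map ((!) xs) \<pi> = map ((!) ys) \<pi>"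
    show "xs = ys"
    proof (rule nth_equalityI)
      fix i assume "i < length xs"
      then have "i \<in> set \<pi>" using xs set_permutation[OF assms] by (auto simp: injections_def)
      then show "xs ! i = ys ! i" using eq by (simp add: map_eq_conv)
    qed (use xs in \<open>auto simp: injections_def\<close>)
  qed
  moreover have "(\<lambda>xs. map ((!) xs) \<pi>) ` injections k n \<subseteq> injections k n"
    using map_nth_injections[OF _ assms] by auto
  ultimately show ?thesis
    by (simp add: bij_betw_def endo_inj_surj)
qed

lemma extend_to_permutation:
  assumes "distinct q" "set q \<subseteq> {..<k}"
  obtains \<pi> where "\<pi> \<in> injections k k" "take (length q) \<pi> = q"
proof
  let ?\<pi> = "q @ sorted_list_of_set ({..<k} - set q)"
  have "length q \<le> k" using assms card_mono[of "{..<k}" "set q"] by (simp add: distinct_card)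
  then show "?\<pi> \<in> injections k k"
    using assms by (auto simp: injections_def card_Diff_subset distinct_card)
qed simp

lemma card_injections_le: "card (injections k n) \<le> n ^ k"
proof -
  have "card (injections k n) \<le> card {xs. set xs \<subseteq> {..<n} \<and> length xs = k}"
    by (rule card_mono) (auto simp: injections_def finite_lists_length_eq)
  then show ?thesis by (simp add: card_lists_length_eq)
qed

text \<open>The falling factorial has \<open>k\<close> factors, each at least \<open>n / 2\<close>
  because \<open>2 * k \<le> n\<close>.\<close>

lemma card_injections_ge:
  assumes "2 * k \<le> n"
  shows "(real n / 2) ^ k \<le> real (card (injections k n))"
proof -
  have "injections k n = {xs. length xs = k \<and> distinct xs \<and> set xs \<subseteq> {..<n}}"
    by (simp add: injections_def)
  then have "card (injections k n) = \<Prod>{n - k + 1..n}"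
    using assms by (simp add: card_lists_distinct_length_eq)
  then have "real (card (injections k n)) = (\<Prod>i\<in>{n - k + 1..n}. real i)" by simp
  moreover have "(\<Prod>i\<in>{n - k + 1..n}. real n / 2) \<le> (\<Prod>i\<in>{n - k + 1..n}. real i)"
    using assms by (intro prod_mono) auto
  moreover have "card {n - k + 1..n} = k" using assms by auto
  ultimately show ?thesis by simp
qed

text \<open>An injective tuple of length \<open>k\<close> has \<open>n - k\<close> extensions by one
  entry. For \<open>k \<ge> n\<close> the truncated difference is zero and no longer tuple exists,
  so both sides vanish.\<close>

lemma sum_injections_Suc:
  fixes f :: "nat list \<Rightarrow> real"
  shows "(\<Sum>xs\<in>injections (Suc k) n. f (take k xs)) = real (n - k) * (\<Sum>ys\<in>injections k n. f ys)"
proof -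
  have "(\<Sum>xs\<in>injections (Suc k) n. f (take k xs)) =
      (\<Sum>(ys, x)\<in>(SIGMA ys:injections k n. {..<n} - set ys). f ys)"
    by (rule sum.reindex_bij_witness[where i = "\<lambda>(ys, x). ys @ [x]" and j = "\<lambda>xs. (butlast xs, last xs)"])
      (auto simp: injections_def length_Suc_conv_rev butlast_conv_take)
  also have "\<dots> = (\<Sum>ys\<in>injections k n. \<Sum>x\<in>{..<n} - set ys. f ys)"
    by (rule sum.Sigma[symmetric]) auto
  also have "\<dots> = (\<Sum>ys\<in>injections k n. real (n - k) * f ys)"
    by (intro sum.cong refl) (auto simp: injections_def card_Diff_subset distinct_card)
  finally show ?thesis by (simp add: sum_distrib_left)
qed

lemma sum_injections_take:
  fixes f :: "nat list \<Rightarrow> real"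
  assumes "j \<le> k"
  shows "(\<Sum>xs\<in>injections k n. f (take j xs)) = (\<Prod>i=j..<k. real (n - i)) * (\<Sum>ys\<in>injections j n. f ys)"
  using assms
proof (induction k rule: dec_induct)
  case base
  then show ?case by (auto simp: injections_def)
next
  case (step k)
  have "(\<Sum>xs\<in>injections (Suc k) n. f (take j xs)) = (\<Sum>xs\<in>injections (Suc k) n. f (take j (take k xs)))"
    using step by (intro sum.cong refl) (simp add: min_def)
  also have "\<dots> = real (n - k) * (\<Sum>ys\<in>injections k n. f (take j ys))"
    by (rule sum_injections_Suc)
  finally show ?case using step by simp
qed

lemma sum_injections_2:
  fixes f :: "nat set \<Rightarrow> real"
  shows "(\<Sum>xs\<in>injections 2 n. f {xs ! 0, xs ! 1}) = 2 * (\<Sum>e\<in>all_edges n. f e)"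
  unfolding sum_injections_subsets all_edges_altdef[symmetric] sum_distrib_left
proof (rule sum.cong)
  fix e assume "e \<in> all_edges n"
  then obtain i j where "e = {i, j}" "i \<noteq> j" by (auto simp: all_edges_def)
  then show "(\<Sum>xs\<in>permutations_of_set e. f {xs ! 0, xs ! 1}) = 2 * f e"
    by (simp add: sum_permutations_of_2 insert_commute)
qed simp

text \<open>Each of the two edges can be listed in two directions, so the fibres have four
  elements.\<close>

lemma sum_injections_4_pairs:
  fixes f :: "nat set \<Rightarrow> nat set \<Rightarrow> real"
  shows "(\<Sum>xs\<in>injections 4 n. f {xs ! 0, xs ! 1} {xs ! 2, xs ! 3}) = 4 * (\<Sum>(e, e')\<in>disjoint_pairs n. f e e')"
proof -
  let ?g = "\<lambda>xs :: nat list. ({xs ! 0, xs ! 1}, {xs ! 2, xs ! 3})"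
  have sub: "?g ` injections 4 n \<subseteq> disjoint_pairs n"
  proof
    fix z assume "z \<in> ?g ` injections 4 n"
    then obtain xs where z: "z = ?g xs" and xs: "xs \<in> injections 4 n" by (rule imageE)
    have neq: "xs ! i \<noteq> xs ! j" if "i < 4" "j < 4" "i \<noteq> j" for i j
      using xs that by (auto simp: injections_def nth_eq_iff_index_eq)
    show "z \<in> disjoint_pairs n"
      unfolding z disjoint_pairs_def
      using neq[of 0 1] neq[of 0 2] neq[of 0 3] neq[of 1 2] neq[of 1 3] neq[of 2 3] injections_nth_less[OF xs]
      by (auto intro!: all_edgesI)
  qed
  have "(\<Sum>xs\<in>injections 4 n. f {xs ! 0, xs ! 1} {xs ! 2, xs ! 3}) =
    (\<Sum>z\<in>disjoint_pairs n. \<Sum>xs\<in>{xs \<in> injections 4 n. ?g xs = z}. f {xs ! 0, xs ! 1} {xs ! 2, xs ! 3})"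
    by (rule sum.group[symmetric]) (use sub in auto)
  also have "\<dots> = (\<Sum>z\<in>disjoint_pairs n. 4 * f (fst z) (snd z))"
  proof (rule sum.cong)
    fix z assume "z \<in> disjoint_pairs n"
    then obtain e e' where z: "z = (e, e')" "e \<in> all_edges n" "e' \<in> all_edges n" "e \<inter> e' = {}"
      by (auto simp: disjoint_pairs_def)
    obtain a b where e: "e = {a, b}" "a \<noteq> b" "a < n" "b < n" using z(2) by (auto simp: all_edges_def)
    obtain c d where e': "e' = {c, d}" "c \<noteq> d" "c < n" "d < n" using z(3) by (auto simp: all_edges_def)
    have neq: "a \<noteq> c" "a \<noteq> d" "b \<noteq> c" "b \<noteq> d" using z(4) e e' by auto
    have fibre: "{xs \<in> injections 4 n. ?g xs = z} = {[a, b, c, d], [b, a, c, d], [a, b, d, c], [b, a, d, c]}"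
    proof (intro equalityI subsetI)
      fix xs assume "xs \<in> {xs \<in> injections 4 n. ?g xs = z}"
      then have xs: "length xs = 4" "{xs ! 0, xs ! 1} = {a, b}" "{xs ! 2, xs ! 3} = {c, d}"
        unfolding z e e' by (auto simp: injections_def)
      from xs(1) have "xs = [xs ! 0, xs ! 1, xs ! 2, xs ! 3]"
        by (intro nth_equalityI) (auto simp: less_Suc_eq numeral_eq_Suc)
      moreover have "xs ! 0 = a \<and> xs ! 1 = b \<or> xs ! 0 = b \<and> xs ! 1 = a" using xs(2) by (auto simp: doubleton_eq_iff)
      moreover have "xs ! 2 = c \<and> xs ! 3 = d \<or> xs ! 2 = d \<and> xs ! 3 = c" using xs(3) by (auto simp: doubleton_eq_iff)
      ultimately show "xs \<in> {[a, b, c, d], [b, a, c, d], [a, b, d, c], [b, a, d, c]}"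
        by (elim disjE conjE) auto
    next
      fix xs assume "xs \<in> {[a, b, c, d], [b, a, c, d], [a, b, d, c], [b, a, d, c]}"
      then show "xs \<in> {xs \<in> injections 4 n. ?g xs = z}"
        using e e' neq unfolding z(1) by (auto simp: injections_def insert_commute)
    qed
    have "(\<Sum>xs\<in>{xs \<in> injections 4 n. ?g xs = z}. f {xs ! 0, xs ! 1} {xs ! 2, xs ! 3}) =
      (\<Sum>xs\<in>{xs \<in> injections 4 n. ?g xs = z}. f e e')"
      by (intro sum.cong refl) (auto simp: z(1))
    also have "\<dots> = real (card {xs \<in> injections 4 n. ?g xs = z}) * f e e'" by simp
    also have "card {xs \<in> injections 4 n. ?g xs = z} = 4"
      unfolding fibre using e(2) e'(2) by simp
    finally show "(\<Sum>xs\<in>{xs \<in> injections 4 n. ?g xs = z}. f {xs ! 0, xs ! 1} {xs ! 2, xs ! 3}) = 4 * f (fst z) (snd z)"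
      by (simp add: z(1))
  qed simp
  finally show ?thesis by (simp add: split_def sum_distrib_left)
qed

section \<open>Induced copies and their labelled embeddings\<close>

definition embeddings :: "nat \<Rightarrow> nat set set \<Rightarrow> nat \<Rightarrow> nat set set \<Rightarrow> nat list set" where
  "embeddings k H n S = {xs \<in> injections k n. \<forall>e\<in>all_edges k. (!) xs ` e \<in> S \<longleftrightarrow> e \<in> H}"

lemma identity_permutation: "[0..<k] \<in> injections k k"
  by (auto simp: injections_def)

lemma identity_automorphism: "H \<subseteq> all_edges k \<Longrightarrow> [0..<k] \<in> embeddings k H k H"
proof -
  have "(!) [0..<k] ` e = e" if "e \<in> all_edges k" for e
    using that by (auto simp: all_edges_def)
  then show ?thesis by (simp add: embeddings_def identity_permutation)
qed

text \<open>The embedding is the inverse of the isomorphism, written as a list.\<close>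

lemma graph_iso_iff_embedding:
  assumes S: "S \<subseteq> all_edges n" and H: "H \<subseteq> all_edges k" and T: "T \<subseteq> {..<n}"
  shows "graph_iso T {e \<in> S. e \<subseteq> T} {..<k} H \<longleftrightarrow> (\<exists>xs\<in>embeddings k H n S. set xs = T)"
proof
  assume "graph_iso T {e \<in> S. e \<subseteq> T} {..<k} H"
  then obtain f where "bij_betw f T {..<k} \<and> (\<forall>u\<in>T. \<forall>v\<in>T. {u, v} \<in> {e \<in> S. e \<subseteq> T} \<longleftrightarrow> {f u, f v} \<in> H)"
    unfolding graph_iso_def ..
  then have f: "bij_betw f T {..<k}"
    and iso: "\<And>u v. u \<in> T \<Longrightarrow> v \<in> T \<Longrightarrow> {u, v} \<in> S \<longleftrightarrow> {f u, f v} \<in> H" by auto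
  let ?g = "inv_into T f"
  have g: "bij_betw ?g {..<k} T" by (rule bij_betw_inv_into[OF f])
  have fg: "f (?g i) = i" if "i < k" for i
    using that by (intro bij_betw_inv_into_right[OF f]) auto
  have gT: "?g i \<in> T" if "i < k" for i using g that by (auto simp: bij_betw_def)
  let ?xs = "map ?g [0..<k]"
  have set: "set ?xs = T" using g by (auto simp: bij_betw_def atLeast0LessThan)
  have "distinct ?xs" using g by (auto simp: distinct_map bij_betw_def atLeast0LessThan)
  then have inj: "?xs \<in> injections k n" using set T by (auto simp: injections_def)
  have "(!) ?xs ` e \<in> S \<longleftrightarrow> e \<in> H" if edge: "e \<in> all_edges k" for e
  proof -
    obtain i j where e: "e = {i, j}" "i < k" "j < k" using edge by (auto simp: all_edges_def)
    then have "(!) ?xs ` e = {?g i, ?g j}" by simp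
    then show ?thesis using iso[OF gT[OF e(2)] gT[OF e(3)]] e by (simp add: fg)
  qed
  then have "?xs \<in> embeddings k H n S" using inj by (simp add: embeddings_def)
  then show "\<exists>xs\<in>embeddings k H n S. set xs = T" using set by blast
next
  assume "\<exists>xs\<in>embeddings k H n S. set xs = T"
  then obtain xs where xs: "xs \<in> injections k n" "set xs = T"
    and emb: "\<And>e. e \<in> all_edges k \<Longrightarrow> (!) xs ` e \<in> S \<longleftrightarrow> e \<in> H"
    by (auto simp: embeddings_def)
  have b: "bij_betw ((!) xs) {..<k} T"
    using xs by (intro bij_betw_nth) (auto simp: injections_def)
  let ?f = "inv_into {..<k} ((!) xs)"
  have f: "bij_betw ?f T {..<k}" by (rule bij_betw_inv_into[OF b])
  have "{u, v} \<in> {e \<in> S. e \<subseteq> T} \<longleftrightarrow> {?f u, ?f v} \<in> H" if "u \<in> T" "v \<in> T" for u v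
  proof -
    have fu: "?f u < k" "xs ! ?f u = u" and fv: "?f v < k" "xs ! ?f v = v"
      using that f bij_betw_inv_into_right[OF b] by (auto simp: bij_betw_def)
    show ?thesis
    \<comment> \<open>\<open>graph_iso\<close> also compares singletons, which are edges of neither
      graph.\<close>
    proof (cases "u = v")
      case True
      then show ?thesis using S H by (auto simp: all_edges_altdef)
    next
      case False
      then have "?f u \<noteq> ?f v" using fu fv by metis
      then have "{?f u, ?f v} \<in> all_edges k" using fu fv by (intro all_edgesI)
      then show ?thesis using emb[of "{?f u, ?f v}"] fu fv that by simp
    qed
  qed
  then have "bij_betw ?f T {..<k} \<and> (\<forall>u\<in>T. \<forall>v\<in>T. {u, v} \<in> {e \<in> S. e \<subseteq> T} \<longleftrightarrow> {?f u, ?f v} \<in> H)"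
    using f by blast
  then show "graph_iso T {e \<in> S. e \<subseteq> T} {..<k} H"
    unfolding graph_iso_def by (rule exI[of _ ?f])
qed

text \<open>\<open>embeddings k H k H\<close> is the automorphism group of \<open>H\<close>.
  Composing a fixed embedding with the automorphisms yields every embedding with the same vertex set
  exactly once.\<close>

lemma card_embeddings_fibre:
  assumes xs0: "xs0 \<in> embeddings k H n S" and H: "H \<subseteq> all_edges k"
  shows "card {xs \<in> embeddings k H n S. set xs = set xs0} = card (embeddings k H k H)"
proof -
  have inj0: "xs0 \<in> injections k n" and len: "length xs0 = k" using xs0 by (auto simp: embeddings_def injections_def)
  have emb0: "\<And>e. e \<in> all_edges k \<Longrightarrow> (!) xs0 ` e \<in> S \<longleftrightarrow> e \<in> H" using xs0 by (auto simp: embeddings_def)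
  have "bij_betw (map ((!) xs0)) (embeddings k H k H) {xs \<in> embeddings k H n S. set xs = set xs0}"
  proof (rule bij_betw_imageI)
    show "inj_on (map ((!) xs0)) (embeddings k H k H)"
    proof (rule inj_onI)
      fix \<pi> \<pi>' assume "\<pi> \<in> embeddings k H k H" "\<pi>' \<in> embeddings k H k H" and eq: "map ((!) xs0) \<pi> = map ((!) xs0) \<pi>'"
      then have "set \<pi> \<union> set \<pi>' \<subseteq> {..<k}" by (auto simp: embeddings_def injections_def)
      then have "inj_on ((!) xs0) (set \<pi> \<union> set \<pi>')" by (rule inj_on_subset[OF injections_inj_on[OF inj0]])
      then show "\<pi> = \<pi>'" using eq by (metis inj_on_map_eq_map)
    qed
    show "map ((!) xs0) ` embeddings k H k H = {xs \<in> embeddings k H n S. set xs = set xs0}"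
    proof (intro equalityI subsetI)
      fix xs assume "xs \<in> map ((!) xs0) ` embeddings k H k H"
      then obtain \<pi> where \<pi>: "xs = map ((!) xs0) \<pi>" "\<pi> \<in> injections k k"
        and aut: "\<And>e. e \<in> all_edges k \<Longrightarrow> (!) \<pi> ` e \<in> H \<longleftrightarrow> e \<in> H" by (auto simp: embeddings_def)
      have "set xs = (!) xs0 ` {..<k}" using \<pi> set_permutation[OF \<pi>(2)] by simp
      also have "\<dots> = set xs0" using len by (auto simp: set_conv_nth)
      finally have "set xs = set xs0" .
      moreover have "xs \<in> injections k n" unfolding \<pi>(1) by (rule map_nth_injections[OF inj0 \<pi>(2)])
      moreover have "(!) xs ` e \<in> S \<longleftrightarrow> e \<in> H" if "e \<in> all_edges k" for e
        unfolding \<pi>(1) nth_map_image[OF \<pi>(2) that]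
        using emb0[OF injections_image_all_edges[OF \<pi>(2) that]] aut[OF that] by simp
      ultimately show "xs \<in> {xs \<in> embeddings k H n S. set xs = set xs0}" by (simp add: embeddings_def)
    next
      fix xs assume "xs \<in> {xs \<in> embeddings k H n S. set xs = set xs0}"
      then have xs: "xs \<in> injections k n" "set xs = set xs0"
        and emb: "\<And>e. e \<in> all_edges k \<Longrightarrow> (!) xs ` e \<in> S \<longleftrightarrow> e \<in> H" by (auto simp: embeddings_def)
      have b: "bij_betw ((!) xs0) {..<k} (set xs0)"
        using inj0 by (intro bij_betw_nth) (auto simp: injections_def)
      let ?\<pi> = "map (inv_into {..<k} ((!) xs0)) xs"
      have r: "xs0 ! inv_into {..<k} ((!) xs0) x = x" if "x \<in> set xs0" for x
        by (rule bij_betw_inv_into_right[OF b that])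
      have eq: "map ((!) xs0) ?\<pi> = xs" unfolding map_map by (rule map_idI) (simp add: r xs(2))
      have "bij_betw (inv_into {..<k} ((!) xs0)) (set xs0) {..<k}" by (rule bij_betw_inv_into[OF b])
      then have \<pi>: "?\<pi> \<in> injections k k"
        using xs by (auto simp: injections_def distinct_map bij_betw_def)
      have "(!) ?\<pi> ` e \<in> H \<longleftrightarrow> e \<in> H" if "e \<in> all_edges k" for e
        using emb[OF that] emb0[OF injections_image_all_edges[OF \<pi> that]]
        unfolding nth_map_image[OF \<pi> that, of xs0, unfolded eq, symmetric] by simp
      then have "?\<pi> \<in> embeddings k H k H" using \<pi> by (simp add: embeddings_def)
      then show "xs \<in> map ((!) xs0) ` embeddings k H k H" using eq by (metis image_eqI)
    qed
  qed
  then show ?thesis by (rule bij_betw_same_card[symmetric])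
qed

text \<open>All fibres of \<open>set\<close> have the same size. The induced count can thus be
  replaced by the labelled count, which expands into products of edge indicators.\<close>

lemma card_embeddings:
  assumes S: "S \<subseteq> all_edges n" and H: "H \<subseteq> all_edges k"
  shows "card (embeddings k H n S) = card (embeddings k H k H) * ind_count {..<k} H n S"
proof -
  let ?E = "embeddings k H n S"
  have fin: "finite ?E" by (simp add: embeddings_def)
  have "{T. T \<subseteq> {..<n} \<and> graph_iso T {e \<in> S. e \<subseteq> T} {..<k} H} = set ` ?E"
  proof (intro equalityI subsetI)
    fix T assume "T \<in> {T. T \<subseteq> {..<n} \<and> graph_iso T {e \<in> S. e \<subseteq> T} {..<k} H}"
    then show "T \<in> set ` ?E" using graph_iso_iff_embedding[OF S H] by auto
  next
    fix T assume T: "T \<in> set ` ?E"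
    then have "T \<subseteq> {..<n}" by (auto simp: embeddings_def injections_def)
    then show "T \<in> {T. T \<subseteq> {..<n} \<and> graph_iso T {e \<in> S. e \<subseteq> T} {..<k} H}"
      using graph_iso_iff_embedding[OF S H, of T] T by auto
  qed
  then have ind: "ind_count {..<k} H n S = card (set ` ?E)" by (simp add: ind_count_def)
  have "card ?E = (\<Sum>T\<in>set ` ?E. card {xs \<in> ?E. set xs = T})"
    using sum.image_gen[OF fin, of "\<lambda>_. 1::nat" set] by simp
  also have "\<dots> = (\<Sum>T\<in>set ` ?E. card (embeddings k H k H))"
    by (intro sum.cong refl) (auto simp: card_embeddings_fibre[OF _ H])
  finally show ?thesis using ind by simp
qed

section \<open>The orthogonal expansion of induced counts\<close>

lemma card_bounded_lists:
  assumes "\<And>i. i < k \<Longrightarrow> finite (B i)"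
  shows "card {ys. length ys = k \<and> (\<forall>i<k. ys ! i \<in> B i)} \<le> (\<Prod>i<k. card (B i))"
proof -
  let ?L = "{ys. length ys = k \<and> (\<forall>i<k. ys ! i \<in> B i)}"
  have "inj_on (\<lambda>ys. restrict ((!) ys) {..<k}) ?L"
  proof (rule inj_onI)
    fix ys zs assume "ys \<in> ?L" "zs \<in> ?L" and eq: "restrict ((!) ys) {..<k} = restrict ((!) zs) {..<k}"
    moreover have "ys ! i = zs ! i" if "i < k" for i using fun_cong[OF eq, of i] that by simp
    ultimately show "ys = zs" by (intro nth_equalityI) auto
  qed
  then have "card ?L = card ((\<lambda>ys. restrict ((!) ys) {..<k}) ` ?L)" by (simp add: card_image)
  also have "\<dots> \<le> card (PiE {..<k} B)"
    by (rule card_mono) (use assms in \<open>auto intro!: finite_PiE simp only: restrict_PiE_iff image_subset_iff mem_Collect_eq lessThan_iff\<close>)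
  finally show ?thesis by (simp add: card_PiE)
qed

text \<open>Every vertex covered by \<open>F\<close> must be sent to one of the \<open>k\<close>
  values of \<open>xs\<close>, and each of the remaining vertices has at most \<open>n\<close>
  choices.\<close>

lemma card_same_relabel_le:
  assumes xs: "xs \<in> injections k n" and F: "F \<subseteq> all_edges k" and large: "s \<le> card (\<Union>F)" and n: "n \<ge> 1"
  shows "card {ys \<in> injections k n. relabel ys F = relabel xs F} \<le> k ^ k * n ^ (k - s)"
proof -
  have U: "\<Union>F \<subseteq> {..<k}" using F by (auto simp: all_edges_altdef)
  then have cardU: "card (\<Union>F) \<le> k" using card_mono[of "{..<k}" "\<Union>F"] by simp
  let ?B = "\<lambda>i. if i \<in> \<Union>F then set xs else {..<n}"
  have "{ys \<in> injections k n. relabel ys F = relabel xs F} \<subseteq> {ys. length ys = k \<and> (\<forall>i<k. ys ! i \<in> ?B i)}"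
  proof (clarify, intro conjI allI impI)
    fix ys i assume ys: "ys \<in> injections k n" "relabel ys F = relabel xs F"
    show "length ys = k" using ys by (simp add: injections_def)
    assume i: "i < k"
    show "ys ! i \<in> ?B i"
    proof (cases "i \<in> \<Union>F")
      case True
      then obtain e where "e \<in> F" "i \<in> e" by auto
      then have "ys ! i \<in> \<Union>(relabel ys F)" by (auto simp: relabel_def)
      also have "\<dots> \<subseteq> set xs"
        unfolding ys(2) using U xs by (fastforce simp: relabel_def injections_def)
      finally show ?thesis using True by simp
    next
      case False
      then show ?thesis using injections_nth_less[OF ys(1) i] by simp
    qed
  qed
  moreover have "finite {ys. length ys = k \<and> (\<forall>i<k. ys ! i \<in> ?B i)}"
  proof (rule finite_subset[OF _ finite_lists_length_eq[of "set xs \<union> {..<n}" k]], intro subsetI CollectI conjI)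
    fix ys x assume ys: "ys \<in> {ys. length ys = k \<and> (\<forall>i<k. ys ! i \<in> ?B i)}"
    then show "length ys = k" by simp
    assume "x \<in> set ys"
    then obtain i where "i < k" "x = ys ! i" using ys by (auto simp: in_set_conv_nth)
    then have "x \<in> ?B i" using ys by simp
    then show "x \<in> set xs \<union> {..<n}" by (simp split: if_splits)
  qed simp
  ultimately have "card {ys \<in> injections k n. relabel ys F = relabel xs F} \<le> card {ys. length ys = k \<and> (\<forall>i<k. ys ! i \<in> ?B i)}"
    by (rule card_mono[rotated])
  also have "\<dots> \<le> (\<Prod>i<k. card (?B i))" by (rule card_bounded_lists) simp
  also have "\<dots> = (\<Prod>i<k. if i \<in> \<Union>F then k else n)"
    using xs by (intro prod.cong) (auto simp: injections_def distinct_card)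
  also have "\<dots> = k ^ card (\<Union>F) * n ^ (k - card (\<Union>F))"
  proof -
    have "{..<k} \<inter> {i. i \<in> \<Union>F} = \<Union>F" "{..<k} \<inter> - {i. i \<in> \<Union>F} = {..<k} - \<Union>F" using U by auto
    moreover have "card ({..<k} - \<Union>F) = k - card (\<Union>F)"
      using U by (simp add: card_Diff_subset finite_subset)
    ultimately show ?thesis by (subst prod.If_cases) simp_all
  qed
  also have "\<dots> \<le> k ^ k * n ^ (k - s)"
    using n cardU large by (cases "k = 0") (auto intro!: mult_mono power_increasing)
  finally show ?thesis .
qed

section \<open>Sums of monomials over all placements of an edge set\<close>

context random_graph
begin

definition placed :: "nat \<Rightarrow> nat set set \<Rightarrow> nat \<Rightarrow> nat set set \<Rightarrow> real" where
  "placed k F n S = (\<Sum>xs\<in>injections k n. monomial (relabel xs F) S)"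

text \<open>There are at most \<open>n^k\<close> injections, and each monomial arises from at most
  \<open>k^k * n^(k - 5)\<close> of them, so zero is already a good approximation. For
  \<open>d = k - 1\<close> the exponent \<open>2 * k - 5\<close> is
  \<open>2 * d - 3\<close>.\<close>

lemma size_approximable_placed_large:
  assumes F: "F \<subseteq> all_edges k" and large: "5 \<le> card (\<Union>F)"
  shows "size_approximable (2 * k - 5) (placed k F)"
proof (rule size_approximableI[where g = "\<lambda>_ _. 0" and R = "placed k F" and K = "real (k ^ k)"])
  fix n
  have U: "\<Union>F \<subseteq> {..<k}" using F by (auto simp: all_edges_altdef)
  then have k: "5 \<le> k" using card_mono[of "{..<k}" "\<Union>F"] large by simp
  show "expect n (\<lambda>S. (placed k F n S)\<^sup>2) \<le> real (k ^ k) * real n ^ (2 * k - 5)"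
  proof (cases "n = 0")
    case True
    then have "injections k n = {}" using k by (auto simp: injections_def)
    then show ?thesis by (simp add: placed_def)
  next
    case False
    have "expect n (\<lambda>S. (placed k F n S)\<^sup>2) \<le>
        real (\<Sum>xs\<in>injections k n. card {ys \<in> injections k n. relabel ys F = relabel xs F})"
      unfolding placed_def by (rule expect_sum_monomials_le) (auto dest: relabel_subset[OF _ F])
    also have "\<dots> \<le> real (\<Sum>xs\<in>injections k n. k ^ k * n ^ (k - 5))"
      using False by (intro of_nat_mono sum_mono card_same_relabel_le F large) auto
    also have "\<dots> \<le> real (n ^ k * (k ^ k * n ^ (k - 5)))"
      unfolding sum_constant by (intro of_nat_mono mult_right_mono) (auto simp: card_injections_le)
    also have "n ^ k * (k ^ k * n ^ (k - 5)) = k ^ k * n ^ (k + (k - 5))"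
      by (simp add: power_add)
    also have "k + (k - 5) = 2 * k - 5" using k by simp
    finally show ?thesis by simp
  qed
qed simp

text \<open>Composition with a permutation only reorders the sum, so \<open>placed\<close> depends
  on the isomorphism type alone.\<close>

lemma placed_relabel:
  assumes "\<pi> \<in> injections k k" "F \<subseteq> all_edges k"
  shows "placed k (relabel \<pi> F) n S = placed k F n S"
proof -
  have "placed k F n S = (\<Sum>xs\<in>injections k n. monomial (relabel (map ((!) xs) \<pi>) F) S)"
    unfolding placed_def
    by (rule sum.reindex_bij_betw[OF bij_betw_map_nth[OF assms(1)], symmetric])
  also have "\<dots> = placed k (relabel \<pi> F) n S"
    unfolding placed_def by (simp add: relabel_map[OF assms])
  finally show ?thesis by simp
qed

lemma size_approximable_placed_empty: "size_approximable r (placed k {})"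
  by (rule size_approximable_cong[OF size_approximable_function[of r "\<lambda>n _. real (card (injections k n))"]])
    (simp add: placed_def relabel_def)

lemma placed_01:
  assumes "2 \<le> k"
  shows "placed k {{0, 1}} n S = (\<Prod>i=2..<k. real (n - i)) * 2 * excess n S"
proof -
  have "placed k {{0, 1}} n S = (\<Sum>xs\<in>injections k n. (\<lambda>ys. centred {ys ! 0, ys ! 1} S) (take 2 xs))"
    by (simp add: placed_def relabel_def)
  also have "\<dots> = (\<Prod>i=2..<k. real (n - i)) * (2 * excess n S)"
    unfolding sum_injections_take[OF assms, where f = "\<lambda>ys. centred {ys ! 0, ys ! 1} S"]
      excess_def sum_injections_2[where f = "\<lambda>e. centred e S"] ..
  finally show ?thesis by simp
qed

lemma size_approximable_placed_01:
  assumes "2 \<le> k"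
  shows "size_approximable r (placed k {{0, 1}})"
  by (rule size_approximable_cong[OF size_approximable_function[of r
        "\<lambda>n m. (\<Prod>i=2..<k. real (n - i)) * 2 * (real m - real (card (all_edges n)) * p)"]])
    (simp only: placed_01[OF assms] excess_eq)

text \<open>The square of the excess splits into equal pairs, cherries and disjoint pairs. On the
  diagonal the square of a centred indicator is again affine in it, with slope
  \<open>1 - 2 * p\<close>.\<close>

lemma sum_disjoint_pairs_centred:
  assumes "S \<subseteq> all_edges n"
  shows "(\<Sum>(e, f)\<in>disjoint_pairs n. centred e S * centred f S) =
    (excess n S)\<^sup>2 - (1 - 2 * p) * excess n S - real (card (all_edges n)) * (p * (1 - p)) - cherry_sum n S"
proof -
  have "(excess n S)\<^sup>2 = (\<Sum>e\<in>all_edges n. \<Sum>f\<in>all_edges n. centred e S * centred f S)"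
    unfolding excess_def power2_eq_square sum_product ..
  also have "\<dots> = (\<Sum>e\<in>all_edges n. centred e S * centred e S) + cherry_sum n S +
      (\<Sum>(e, f)\<in>disjoint_pairs n. centred e S * centred f S)"
    unfolding sum_edge_pairs cherry_sum_def ..
  also have "(\<Sum>e\<in>all_edges n. centred e S * centred e S) =
      (\<Sum>e\<in>all_edges n. (1 - 2 * p) * centred e S + p * (1 - p))"
    by (intro sum.cong refl) (auto simp: centred_def algebra_simps)
  also have "\<dots> = (1 - 2 * p) * excess n S + real (card (all_edges n)) * (p * (1 - p))"
    by (simp add: sum.distrib sum_distrib_left excess_def)
  finally show ?thesis by simp
qed

text \<open>The quadratic polynomial in the excess is a function of the edge count. What remains is
  the cherry sum times a factor of order at most \<open>n^(k - 4)\<close>, with second moment of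
  order at most \<open>n^(2 * (k - 4) + 3)\<close>.\<close>

lemma size_approximable_placed_01_23:
  assumes "4 \<le> k"
  shows "size_approximable (2 * k - 5) (placed k {{0, 1}, {2, 3}})"
proof -
  let ?c = "\<lambda>n. (\<Prod>i=4..<k. real (n - i)) * 4"
  let ?g = "\<lambda>n m. ?c n * ((real m - real (card (all_edges n)) * p)\<^sup>2 -
    (1 - 2 * p) * (real m - real (card (all_edges n)) * p) - real (card (all_edges n)) * (p * (1 - p)))"
  have placed: "placed k {{0, 1}, {2, 3}} n S = ?g n (card S) + - ?c n * cherry_sum n S"
    if S: "S \<subseteq> all_edges n" for n S
  proof -
    have "placed k {{0, 1}, {2, 3}} n S =
        (\<Sum>xs\<in>injections k n. (\<lambda>ys. centred {ys ! 0, ys ! 1} S * centred {ys ! 2, ys ! 3} S) (take 4 xs))"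
      unfolding placed_def
    proof (intro sum.cong refl)
      fix xs assume xs: "xs \<in> injections k n"
      have "{{0, 1}, {2, 3}} \<subseteq> all_edges k" using assms by (auto intro!: all_edgesI)
      then have "monomial (relabel xs {{0, 1}, {2, 3}}) S = (\<Prod>e\<in>{{0, 1}, {2, 3}}. centred ((!) xs ` e) S)"
        unfolding monomial_def by (rule prod_relabel[OF xs])
      also have "\<dots> = centred {xs ! 0, xs ! 1} S * centred {xs ! 2, xs ! 3} S"
        by (simp add: doubleton_eq_iff)
      finally show "monomial (relabel xs {{0, 1}, {2, 3}}) S =
          (\<lambda>ys. centred {ys ! 0, ys ! 1} S * centred {ys ! 2, ys ! 3} S) (take 4 xs)" by simp
    qed
    also have "\<dots> = (\<Prod>i=4..<k. real (n - i)) * (4 * (\<Sum>(e, f)\<in>disjoint_pairs n. centred e S * centred f S))"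
      unfolding sum_injections_take[OF assms,
          where f = "\<lambda>ys. centred {ys ! 0, ys ! 1} S * centred {ys ! 2, ys ! 3} S"]
        sum_injections_4_pairs[where f = "\<lambda>e f. centred e S * centred f S"] ..
    finally show ?thesis
      unfolding sum_disjoint_pairs_centred[OF S] excess_eq[OF S] by (simp add: algebra_simps)
  qed
  have c: "(?c n)\<^sup>2 \<le> 16 * real n ^ (2 * k - 8)" and c0: "0 \<le> ?c n" for n
  proof -
    have "(\<Prod>i=4..<k. real (n - i)) \<le> (\<Prod>i=4..<k. real n)" by (intro prod_mono) auto
    also have "\<dots> = real n ^ (k - 4)" by simp
    finally have "((\<Prod>i=4..<k. real (n - i)))\<^sup>2 \<le> (real n ^ (k - 4))\<^sup>2"
      by (intro power_mono prod_nonneg) auto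
    also have "\<dots> = real n ^ (2 * k - 8)" by (simp flip: power_mult add: algebra_simps)
    finally show "(?c n)\<^sup>2 \<le> 16 * real n ^ (2 * k - 8)" by (simp add: power_mult_distrib)
    show "0 \<le> ?c n" by (simp add: prod_nonneg)
  qed
  show ?thesis
  proof (rule size_approximableI[where g = ?g and R = "\<lambda>n S. - ?c n * cherry_sum n S" and K = 32])
    fix n
    have "expect n (\<lambda>S. (- ?c n * cherry_sum n S)\<^sup>2) = (?c n)\<^sup>2 * expect n (\<lambda>S. (cherry_sum n S)\<^sup>2)"
      unfolding power_mult_distrib expect_cmult by simp
    also have "\<dots> \<le> (16 * real n ^ (2 * k - 8)) * (2 * real n ^ 3)"
      by (intro mult_mono c expect_cherry_sum_sq expect_nonneg) auto
    also have "\<dots> = 32 * real n ^ (2 * k - 8 + 3)" by (simp add: power_add)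
    also have "2 * k - 8 + 3 = 2 * k - 5" using assms by simp
    finally show "expect n (\<lambda>S. (- ?c n * cherry_sum n S)\<^sup>2) \<le> 32 * real n ^ (2 * k - 5)" .
  qed (rule placed)
qed

text \<open>A matching inside four vertices has at most two edges, so it is a relabelling of one of
  three model cases.\<close>

lemma size_approximable_placed_matching:
  assumes k: "4 \<le> k" and G: "G \<subseteq> all_edges 4" "pairwise disjnt G"
  shows "size_approximable (2 * k - 5) (placed k G)"
proof -
  have fin: "finite G" using G(1) finite_subset by auto
  have card2: "card e = 2" "finite e" if "e \<in> G" for e
    using that G(1) finite_subset[of e "{..<4}"] by (auto simp: all_edges_altdef)
  have "2 * card G = card (\<Union>G)"
    using card2 G(2) by (simp add: card_Union_disjoint)
  also have "\<dots> \<le> card {..<4::nat}"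
    by (rule card_mono) (use G(1) in \<open>auto simp: all_edges_altdef\<close>)
  finally consider "card G = 0" | "card G = 1" | "card G = 2" by fastforce
  then show ?thesis
  proof cases
    case 1
    then have "G = {}" using fin by simp
    then show ?thesis by (simp add: size_approximable_placed_empty)
  next
    case 2
    then obtain e where e: "G = {e}" by (auto simp: card_1_singleton_iff)
    then obtain i j where ij: "e = {i, j}" "i < 4" "j < 4" "i \<noteq> j" using G(1) by (auto simp: all_edges_def)
    obtain \<pi> where \<pi>: "\<pi> \<in> injections k k" "take (length [i, j]) \<pi> = [i, j]"
      by (rule extend_to_permutation[of "[i, j]" k]) (use ij k in auto)
    have "\<pi> ! 0 = i" "\<pi> ! 1 = j"
      using arg_cong[OF \<pi>(2), of "\<lambda>ys. ys ! 0"] arg_cong[OF \<pi>(2), of "\<lambda>ys. ys ! 1"] by simp_all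
    then have "G = relabel \<pi> {{0, 1}}" using e ij by (simp add: relabel_def)
    moreover have "{{0, 1}} \<subseteq> all_edges k" using k by (auto intro!: all_edgesI)
    ultimately have "placed k G n S = placed k {{0, 1}} n S" for n S using placed_relabel[OF \<pi>(1)] by simp
    then show ?thesis
      using k by (intro size_approximable_cong[OF size_approximable_placed_01]) auto
  next
    case 3
    then obtain e f where ef: "G = {e, f}" "e \<noteq> f" by (auto simp: card_2_iff)
    then have disj: "e \<inter> f = {}" using G(2) by (auto simp: pairwise_def disjnt_def)
    obtain i j where ij: "e = {i, j}" "i < 4" "j < 4" "i \<noteq> j" using G(1) ef by (auto simp: all_edges_def)
    obtain l m where lm: "f = {l, m}" "l < 4" "m < 4" "l \<noteq> m" using G(1) ef by (auto simp: all_edges_def)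
    obtain \<pi> where \<pi>: "\<pi> \<in> injections k k" "take (length [i, j, l, m]) \<pi> = [i, j, l, m]"
      by (rule extend_to_permutation[of "[i, j, l, m]" k]) (use ij lm disj k in auto)
    have "\<pi> ! 0 = i" "\<pi> ! 1 = j" "\<pi> ! 2 = l" "\<pi> ! 3 = m"
      using arg_cong[OF \<pi>(2), of "\<lambda>ys. ys ! 0"] arg_cong[OF \<pi>(2), of "\<lambda>ys. ys ! 1"]
        arg_cong[OF \<pi>(2), of "\<lambda>ys. ys ! 2"] arg_cong[OF \<pi>(2), of "\<lambda>ys. ys ! 3"] by simp_all
    then have "G = relabel \<pi> {{0, 1}, {2, 3}}" using ef ij lm by (simp add: relabel_def numeral_eq_Suc)
    moreover have "{{0, 1}, {2, 3}} \<subseteq> all_edges k" using k by (auto intro!: all_edgesI)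
    ultimately have "placed k G n S = placed k {{0, 1}, {2, 3}} n S" for n S using placed_relabel[OF \<pi>(1)] by simp
    then show ?thesis
      using k by (intro size_approximable_cong[OF size_approximable_placed_01_23]) auto
  qed
qed

text \<open>By orthogonality only single edges correlate with the excess, and each placement of a
  single edge meets exactly one of its summands.\<close>

lemma expect_placed_excess:
  assumes F: "F \<subseteq> all_edges k"
  shows "expect n (\<lambda>S. placed k F n S * excess n S) =
    (if card F = 1 then real (card (injections k n)) * (p * (1 - p)) else 0)"
proof -
  have "expect n (\<lambda>S. placed k F n S * excess n S) =
    (\<Sum>xs\<in>injections k n. \<Sum>g\<in>all_edges n. expect n (\<lambda>S. monomial (relabel xs F) S * monomial {g} S))"
    unfolding placed_def excess_def sum_product expect_sum by simp
  also have "\<dots> = (\<Sum>xs\<in>injections k n. if card F = 1 then p * (1 - p) else 0)"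
  proof (rule sum.cong)
    fix xs assume xs: "xs \<in> injections k n"
    have "(\<Sum>g\<in>all_edges n. expect n (\<lambda>S. monomial (relabel xs F) S * monomial {g} S)) =
      (\<Sum>g\<in>all_edges n. if relabel xs F = {g} then (p * (1 - p)) ^ card (relabel xs F) else 0)"
      by (intro sum.cong refl expect_monomial_mult relabel_subset[OF xs F]) auto
    also have "\<dots> = (if card F = 1 then p * (1 - p) else 0)"
    proof (cases "card F = 1")
      case True
      then have "card (relabel xs F) = 1" by (simp add: card_relabel[OF xs F])
      then obtain g where g: "relabel xs F = {g}" by (auto simp: card_1_singleton_iff)
      then have "g \<in> all_edges n" using relabel_subset[OF xs F] by auto
      then show ?thesis using True unfolding g by simp
    next
      case False
      then have "card (relabel xs F) \<noteq> 1" by (simp add: card_relabel[OF xs F])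
      then have "relabel xs F \<noteq> {g}" for g by auto
      then show ?thesis using False by simp
    qed
    finally show "(\<Sum>g\<in>all_edges n. expect n (\<lambda>S. monomial (relabel xs F) S * monomial {g} S)) =
      (if card F = 1 then p * (1 - p) else 0)" .
  qed simp
  finally show ?thesis by simp
qed

end

section \<open>Averaged weights of edge sets on at most four vertices\<close>

lemma small_edge_set_relabel:
  assumes F: "F \<subseteq> all_edges k" and small: "card (\<Union>F) \<le> 4" and k: "4 \<le> k"
  obtains \<pi> G where "\<pi> \<in> injections k k" "G \<subseteq> all_edges 4" "F = relabel \<pi> G"
proof -
  have U: "\<Union>F \<subseteq> {..<k}" using F by (auto simp: all_edges_altdef)
  have "4 - card (\<Union>F) \<le> card ({..<k} - \<Union>F)"
    using U k by (simp add: card_Diff_subset finite_subset)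
  then obtain W where W: "W \<subseteq> {..<k} - \<Union>F" "card W = 4 - card (\<Union>F)" "finite W"
    by (rule obtain_subset_with_card_n)
  \<comment> \<open>\<open>F\<close> may cover fewer than four vertices; \<open>W\<close> pads them
    to exactly four, and a permutation that starts with these four labels allows pulling
    \<open>F\<close> back to an edge set on the first four vertices.\<close>
  define Q where "Q = \<Union>F \<union> W"
  have Q: "Q \<subseteq> {..<k}" "finite Q" using U W by (auto simp: Q_def intro: finite_subset)
  have cardQ: "card Q = 4"
    unfolding Q_def using W small U by (subst card_Un_disjoint) (auto intro: finite_subset)
  let ?q = "sorted_list_of_set Q"
  obtain \<pi> where \<pi>: "\<pi> \<in> injections k k" "take (length ?q) \<pi> = ?q"
    by (rule extend_to_permutation[of ?q k]) (use Q in auto)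
  have len: "length ?q = 4" using cardQ by simp
  have nth: "\<pi> ! i = ?q ! i" if "i < 4" for i
    using that len \<pi>(2) by (metis nth_take)
  have img: "Q \<subseteq> (!) \<pi> ` {..<4}"
  proof
    fix x assume "x \<in> Q"
    then have "x \<in> set ?q" using Q by simp
    then obtain i where "i < 4" "?q ! i = x" using len by (metis in_set_conv_nth)
    then show "x \<in> (!) \<pi> ` {..<4}" using nth by (metis image_eqI lessThan_iff)
  qed
  define G where "G = {g \<in> all_edges 4. (!) \<pi> ` g \<in> F}"
  have "F = relabel \<pi> G"
  proof (intro equalityI subsetI)
    fix e assume e: "e \<in> F"
    then have "e \<subseteq> (!) \<pi> ` {..<4}" using img by (auto simp: Q_def)
    then obtain g where g: "g \<subseteq> {..<4}" "e = (!) \<pi> ` g" by (auto simp: subset_image_iff)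
    have "inj_on ((!) \<pi>) g"
      by (rule inj_on_subset[OF injections_inj_on[OF \<pi>(1)]]) (use g k in auto)
    then have "card g = 2" using e F g(2) by (auto simp: all_edges_altdef card_image)
    then have "g \<in> G" using g e by (simp add: G_def all_edges_altdef)
    then show "e \<in> relabel \<pi> G" using g by (auto simp: relabel_def)
  qed (auto simp: relabel_def G_def)
  moreover have "G \<subseteq> all_edges 4" by (auto simp: G_def)
  ultimately show ?thesis using \<pi>(1) that by blast
qed

definition edge_sign :: "nat set set \<Rightarrow> nat set \<Rightarrow> real" where
  "edge_sign H e = (if e \<in> H then 1 else -1)"

text \<open>
  The coefficient of the monomial of \<open>F\<close> in the indicator of an induced embedding of \<open>H\<close> when \<open>p = 1/2\<close>.
\<close>

definition edge_weight :: "nat \<Rightarrow> nat set set \<Rightarrow> nat set set \<Rightarrow> real" where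
  "edge_weight k H F = (1 / 2) ^ (card (all_edges k) - card F) * (\<Prod>e\<in>F. edge_sign H e)"

lemma edge_weight_relabel:
  assumes \<pi>: "\<pi> \<in> injections k k" and F: "F \<subseteq> all_edges k"
  shows "edge_weight k H (relabel \<pi> F) =
    (1 / 2) ^ (card (all_edges k) - card F) * (\<Prod>e\<in>F. edge_sign H ((!) \<pi> ` e))"
  unfolding edge_weight_def card_relabel[OF assms] prod_relabel[OF assms] ..

text \<open>The sum over all permutations absorbs \<open>\<sigma>\<close>, and the edge signs depend
  on the first four values only. Each averaged weight is thus a multiple of a sum over placements of
  \<open>G\<close> in \<open>H\<close>.\<close>

lemma sum_edge_weight_relabel:
  assumes k: "4 \<le> k" and \<sigma>: "\<sigma> \<in> injections k k" and G: "G \<subseteq> all_edges 4"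
  shows "(\<Sum>\<pi>\<in>injections k k. edge_weight k H (relabel \<pi> (relabel \<sigma> G))) =
    (1 / 2) ^ (card (all_edges k) - card G) * ((\<Prod>i=4..<k. real (k - i)) *
      (\<Sum>xs\<in>injections 4 k. \<Prod>e\<in>G. edge_sign H ((!) xs ` e)))"
proof -
  have Gk: "G \<subseteq> all_edges k" using G all_edges_mono[OF k] by blast
  have "(\<Sum>\<pi>\<in>injections k k. edge_weight k H (relabel \<pi> (relabel \<sigma> G))) =
      (\<Sum>\<pi>\<in>injections k k. edge_weight k H (relabel (map ((!) \<pi>) \<sigma>) G))"
    by (simp add: relabel_map[OF \<sigma> Gk])
  also have "\<dots> = (\<Sum>\<pi>\<in>injections k k. edge_weight k H (relabel \<pi> G))"
    by (rule sum.reindex_bij_betw[OF bij_betw_map_nth[OF \<sigma>]])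
  also have "\<dots> = (\<Sum>\<pi>\<in>injections k k. (1 / 2) ^ (card (all_edges k) - card G) *
      (\<Prod>e\<in>G. edge_sign H ((!) (take 4 \<pi>) ` e)))"
  proof (rule sum.cong)
    fix \<pi> assume \<pi>: "\<pi> \<in> injections k k"
    have "(!) (take 4 \<pi>) ` e = (!) \<pi> ` e" if "e \<in> G" for e
      using subsetD[OF G that] by (auto simp: all_edges_def)
    then show "edge_weight k H (relabel \<pi> G) = (1 / 2) ^ (card (all_edges k) - card G) *
        (\<Prod>e\<in>G. edge_sign H ((!) (take 4 \<pi>) ` e))"
      unfolding edge_weight_relabel[OF \<pi> Gk] by simp
  qed simp
  also have "\<dots> = (1 / 2) ^ (card (all_edges k) - card G) * ((\<Prod>i=4..<k. real (k - i)) *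
      (\<Sum>xs\<in>injections 4 k. \<Prod>e\<in>G. edge_sign H ((!) xs ` e)))"
    unfolding sum_distrib_left[symmetric]
      sum_injections_take[OF k, where f = "\<lambda>ys. \<Prod>e\<in>G. edge_sign H ((!) ys ` e)"] ..
  finally show ?thesis .
qed

definition small_edge_sets :: "nat \<Rightarrow> nat set set set" where
  "small_edge_sets k = {F. F \<subseteq> all_edges k \<and> card (\<Union>F) \<le> 4}"

lemma finite_small_edge_sets [simp]: "finite (small_edge_sets k)"
  by (rule finite_subset[of _ "Pow (all_edges k)"]) (auto simp: small_edge_sets_def)

lemma bij_betw_relabel_small:
  assumes \<pi>: "\<pi> \<in> injections k k"
  shows "bij_betw (relabel \<pi>) (small_edge_sets k) (small_edge_sets k)"
proof -
  have "inj_on (relabel \<pi>) (small_edge_sets k)"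
    unfolding relabel_def[abs_def]
    by (rule inj_on_subset[OF inj_on_image_Pow[OF inj_on_image_all_edges[OF \<pi>]]])
      (auto simp: small_edge_sets_def)
  moreover have "relabel \<pi> ` small_edge_sets k \<subseteq> small_edge_sets k"
  proof (intro image_subsetI)
    fix F assume F: "F \<in> small_edge_sets k"
    then have sub: "F \<subseteq> all_edges k" "\<Union>F \<subseteq> {..<k}" by (auto simp: small_edge_sets_def all_edges_altdef)
    have "\<Union>(relabel \<pi> F) = (!) \<pi> ` \<Union>F" by (auto simp: relabel_def)
    then have "card (\<Union>(relabel \<pi> F)) \<le> card (\<Union>F)"
      using card_image_le[OF finite_subset[OF sub(2)], of "(!) \<pi>"] by simp
    then show "relabel \<pi> F \<in> small_edge_sets k"
      using F relabel_subset[OF \<pi> sub(1)] by (simp add: small_edge_sets_def)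
  qed
  ultimately show ?thesis by (simp add: bij_betw_def endo_inj_surj)
qed

context random_graph
begin

text \<open>
  As \<open>placed k F\<close> only depends on the isomorphism type of \<open>F\<close>, each weight may be replaced by its average.
\<close>

lemma average_small_edge_sets:
  "real (card (injections k k)) * (\<Sum>F\<in>small_edge_sets k. edge_weight k H F * placed k F n S) =
    (\<Sum>F\<in>small_edge_sets k. (\<Sum>\<pi>\<in>injections k k. edge_weight k H (relabel \<pi> F)) * placed k F n S)"
proof -
  have "(\<Sum>F\<in>small_edge_sets k. (\<Sum>\<pi>\<in>injections k k. edge_weight k H (relabel \<pi> F)) * placed k F n S) =
      (\<Sum>\<pi>\<in>injections k k. \<Sum>F\<in>small_edge_sets k. edge_weight k H (relabel \<pi> F) * placed k F n S)"
    unfolding sum_distrib_right by (rule sum.swap)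
  also have "\<dots> = (\<Sum>\<pi>\<in>injections k k. \<Sum>F\<in>small_edge_sets k. edge_weight k H F * placed k F n S)"
  proof (rule sum.cong)
    fix \<pi> assume \<pi>: "\<pi> \<in> injections k k"
    have "(\<Sum>F\<in>small_edge_sets k. edge_weight k H (relabel \<pi> F) * placed k F n S) =
      (\<Sum>F\<in>small_edge_sets k. edge_weight k H (relabel \<pi> F) * placed k (relabel \<pi> F) n S)"
      by (intro sum.cong refl) (simp add: placed_relabel[OF \<pi>] small_edge_sets_def)
    also have "\<dots> = (\<Sum>F\<in>small_edge_sets k. edge_weight k H F * placed k F n S)"
      by (rule sum.reindex_bij_betw[OF bij_betw_relabel_small[OF \<pi>]])
    finally show "(\<Sum>F\<in>small_edge_sets k. edge_weight k H (relabel \<pi> F) * placed k F n S) =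
      (\<Sum>F\<in>small_edge_sets k. edge_weight k H F * placed k F n S)" .
  qed simp
  finally show ?thesis by simp
qed

text \<open>After averaging, \<open>vanish\<close> removes every isomorphism type that is not a
  matching, and matchings are approximable by
  \<open>size_approximable_placed_matching\<close>.\<close>

lemma size_approximable_small:
  assumes k: "4 \<le> k"
    and vanish: "\<And>G. G \<subseteq> all_edges 4 \<Longrightarrow> \<not> pairwise disjnt G \<Longrightarrow>
      (\<Sum>xs\<in>injections 4 k. \<Prod>e\<in>G. edge_sign H ((!) xs ` e)) = 0"
  shows "size_approximable (2 * k - 5) (\<lambda>n S. \<Sum>F\<in>small_edge_sets k. edge_weight k H F * placed k F n S)"
proof -
  let ?c = "\<lambda>F. \<Sum>\<pi>\<in>injections k k. edge_weight k H (relabel \<pi> F)"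
  have summand: "size_approximable (2 * k - 5) (\<lambda>n S. ?c F * placed k F n S)" if F: "F \<in> small_edge_sets k" for F
  proof -
    have "F \<subseteq> all_edges k" "card (\<Union>F) \<le> 4" using F by (auto simp: small_edge_sets_def)
    then obtain \<sigma> G where \<sigma>: "\<sigma> \<in> injections k k" and G: "G \<subseteq> all_edges 4" and FG: "F = relabel \<sigma> G"
      using small_edge_set_relabel k by metis
    have Gk: "G \<subseteq> all_edges k" using G all_edges_mono[OF k] by blast
    show ?thesis
    proof (cases "pairwise disjnt G")
      case True
      show ?thesis
        by (rule size_approximable_cong[OF size_approximable_cmult[where c = "?c F", OF size_approximable_placed_matching[OF k G True]]])
          (simp add: FG placed_relabel[OF \<sigma> Gk])
    next
      case False
      have "?c F = 0" unfolding FG sum_edge_weight_relabel[OF k \<sigma> G] vanish[OF G False] by simp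
      then show ?thesis using size_approximable_function[of "2 * k - 5" "\<lambda>_ _. 0"] by simp
    qed
  qed
  have "card (injections k k) \<noteq> 0" using identity_permutation[of k] by (auto simp: card_eq_0_iff)
  then have eq: "(\<Sum>F\<in>small_edge_sets k. edge_weight k H F * placed k F n S) =
      1 / real (card (injections k k)) * (\<Sum>F\<in>small_edge_sets k. ?c F * placed k F n S)" for n S
    unfolding average_small_edge_sets[symmetric] by simp
  show ?thesis unfolding eq
    by (intro size_approximable_cmult size_approximable_sum finite_small_edge_sets summand)
qed

text \<open>For \<open>p = 1 / 2\<close> the indicator that a pair of vertices has the prescribed
  status is 1/2 plus or minus its centred indicator. Multiplying out over all pairs gives one term
  for each edge set \<open>F\<close>.\<close>

lemma card_embeddings_expansion:
  assumes p: "p = 1 / 2" and H: "H \<subseteq> all_edges k"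
  shows "real (card (embeddings k H n S)) = (\<Sum>F\<in>Pow (all_edges k). edge_weight k H F * placed k F n S)"
proof -
  have "real (card (embeddings k H n S)) =
      (\<Sum>xs\<in>injections k n. of_bool (\<forall>e\<in>all_edges k. (!) xs ` e \<in> S \<longleftrightarrow> e \<in> H))"
    by (simp add: embeddings_def sum_of_bool_eq Int_def)
  also have "\<dots> = (\<Sum>xs\<in>injections k n. \<Sum>F\<in>Pow (all_edges k). edge_weight k H F * monomial (relabel xs F) S)"
  proof (rule sum.cong)
    fix xs assume xs: "xs \<in> injections k n"
    have "of_bool (\<forall>e\<in>all_edges k. (!) xs ` e \<in> S \<longleftrightarrow> e \<in> H) =
        (\<Prod>e\<in>all_edges k. of_bool ((!) xs ` e \<in> S \<longleftrightarrow> e \<in> H) :: real)"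
      by (auto simp: prod_zero_iff intro!: prod.neutral)
    also have "\<dots> = (\<Prod>e\<in>all_edges k. edge_sign H e * centred ((!) xs ` e) S + 1 / 2)"
      unfolding edge_sign_def centred_def by (intro prod.cong refl) (auto simp: p)
    also have "\<dots> = (\<Sum>F\<in>Pow (all_edges k). (\<Prod>e\<in>F. edge_sign H e * centred ((!) xs ` e) S) * (\<Prod>e\<in>all_edges k - F. 1 / 2))"
      by (rule prod_add) simp
    also have "\<dots> = (\<Sum>F\<in>Pow (all_edges k). edge_weight k H F * monomial (relabel xs F) S)"
    proof (rule sum.cong)
      fix F assume "F \<in> Pow (all_edges k)"
      then have F: "F \<subseteq> all_edges k" by simp
      then have "card (all_edges k - F) = card (all_edges k) - card F"
        by (intro card_Diff_subset) (auto intro: finite_subset)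
      then show "(\<Prod>e\<in>F. edge_sign H e * centred ((!) xs ` e) S) * (\<Prod>e\<in>all_edges k - F. 1 / 2) =
          edge_weight k H F * monomial (relabel xs F) S"
        unfolding monomial_def prod_relabel[OF xs F] edge_weight_def prod.distrib prod_constant by simp
    qed simp
    finally show "of_bool (\<forall>e\<in>all_edges k. (!) xs ` e \<in> S \<longleftrightarrow> e \<in> H) =
        (\<Sum>F\<in>Pow (all_edges k). edge_weight k H F * monomial (relabel xs F) S)" .
  qed simp
  also have "\<dots> = (\<Sum>F\<in>Pow (all_edges k). edge_weight k H F * placed k F n S)"
    unfolding placed_def sum_distrib_left by (rule sum.swap)
  finally show ?thesis .
qed

text \<open>Edge sets on five or more vertices are negligible one by one; only the smaller ones
  require the cancellation obtained by averaging.\<close>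

lemma size_approximable_card_embeddings:
  assumes p: "p = 1 / 2" and k: "4 \<le> k" and H: "H \<subseteq> all_edges k"
    and vanish: "\<And>G. G \<subseteq> all_edges 4 \<Longrightarrow> \<not> pairwise disjnt G \<Longrightarrow>
      (\<Sum>xs\<in>injections 4 k. \<Prod>e\<in>G. edge_sign H ((!) xs ` e)) = 0"
  shows "size_approximable (2 * k - 5) (\<lambda>n S. real (card (embeddings k H n S)))"
proof -
  let ?L = "Pow (all_edges k) - small_edge_sets k"
  have decomposition: "real (card (embeddings k H n S)) = (\<Sum>F\<in>?L. edge_weight k H F * placed k F n S) +
      (\<Sum>F\<in>small_edge_sets k. edge_weight k H F * placed k F n S)" for n S
    unfolding card_embeddings_expansion[OF p H]
    by (rule sum.subset_diff) (auto simp: small_edge_sets_def)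
  show ?thesis
    unfolding decomposition
  proof (rule size_approximable_add[OF size_approximable_sum size_approximable_small[OF k vanish]])
    fix F assume "F \<in> ?L"
    then show "size_approximable (2 * k - 5) (\<lambda>n S. edge_weight k H F * placed k F n S)"
      by (intro size_approximable_cmult size_approximable_placed_large) (auto simp: small_edge_sets_def)
  qed auto
qed

text \<open>Only the weights of single edges survive, and their sum is proportional to the
  difference between the numbers of edges and non-edges of \<open>H\<close>.\<close>

lemma expect_card_embeddings_excess:
  assumes p: "p = 1 / 2" and H: "H \<subseteq> all_edges k"
  shows "expect n (\<lambda>S. real (card (embeddings k H n S)) * excess n S) =
    (1 / 2) ^ (card (all_edges k) - 1) * (p * (1 - p)) * (\<Sum>e\<in>all_edges k. edge_sign H e) * real (card (injections k n))"
proof -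
  let ?v = "real (card (injections k n)) * (p * (1 - p))"
  have "expect n (\<lambda>S. real (card (embeddings k H n S)) * excess n S) =
    (\<Sum>F\<in>Pow (all_edges k). edge_weight k H F * expect n (\<lambda>S. placed k F n S * excess n S))"
    unfolding card_embeddings_expansion[OF p H] sum_distrib_right expect_sum mult.assoc expect_cmult ..
  also have "\<dots> = (\<Sum>F\<in>Pow (all_edges k). if card F = 1 then edge_weight k H F * ?v else 0)"
    by (intro sum.cong refl) (simp add: expect_placed_excess)
  also have "\<dots> = (\<Sum>F\<in>(\<lambda>e. {e}) ` all_edges k. edge_weight k H F * ?v)"
    by (rule sum.mono_neutral_cong_right) (auto simp: card_1_singleton_iff)
  also have "\<dots> = (\<Sum>e\<in>all_edges k. edge_weight k H {e} * ?v)"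
    by (subst sum.reindex) auto
  also have "\<dots> = (1 / 2) ^ (card (all_edges k) - 1) * (p * (1 - p)) * (\<Sum>e\<in>all_edges k. edge_sign H e) * real (card (injections k n))"
    by (simp add: edge_weight_def sum_distrib_left sum_distrib_right mult_ac)
  finally show ?thesis .
qed

text \<open>The criterion applies with \<open>d = k - 1\<close>: \<open>vanish\<close> bounds the
  remainder, and \<open>nonzero\<close> makes the covariance with the edge count of order
  \<open>n^k\<close>.\<close>

theorem induced_anticoncentration_failure:
  assumes p: "p = 1 / 2" and k: "4 \<le> k" and H: "H \<subseteq> all_edges k"
    and vanish: "\<And>G. G \<subseteq> all_edges 4 \<Longrightarrow> \<not> pairwise disjnt G \<Longrightarrow>
      (\<Sum>xs\<in>injections 4 k. \<Prod>e\<in>G. edge_sign H ((!) xs ` e)) = 0"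
    and nonzero: "(\<Sum>e\<in>all_edges k. edge_sign H e) \<noteq> 0"
  shows "\<exists>c>0. \<forall>\<^sub>F n in sequentially.
    c * sqrt (real n) / std_dev (gnp n p) (\<lambda>S. real (ind_count {..<k} H n S))
    \<le> max_point_prob (gnp n p) (\<lambda>S. real (ind_count {..<k} H n S))"
proof -
  let ?aut = "real (card (embeddings k H k H))"
  let ?C = "(1 / 2) ^ (card (all_edges k) - 1) * (p * (1 - p)) * (\<Sum>e\<in>all_edges k. edge_sign H e) / ?aut"
  have "finite (embeddings k H k H)" by (simp add: embeddings_def)
  then have aut: "?aut > 0" using identity_automorphism[OF H] by (auto simp: card_gt_0_iff)
  have C: "\<bar>?C\<bar> > 0" using nonzero aut p_pos p_less_1 by (simp add: abs_mult)
  have ind: "real (ind_count {..<k} H n S) = 1 / ?aut * real (card (embeddings k H n S))"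
    if "S \<subseteq> all_edges n" for n S
    unfolding card_embeddings[OF that H] using aut by simp
  show ?thesis
  \<comment> \<open>The denominator \<open>2 ^ k\<close> comes from the lower bound in
    \<open>card_injections_ge\<close>.\<close>
  proof (rule anticoncentration_failure[where d = "k - 1" and a = "\<bar>?C\<bar> / 2 ^ k"])
    have "size_approximable (2 * k - 5) (\<lambda>n S. real (ind_count {..<k} H n S))"
      by (rule size_approximable_cong[OF size_approximable_cmult[where c = "1 / ?aut", OF size_approximable_card_embeddings[OF p k H vanish]]])
        (simp_all add: ind)
    moreover have "2 * (k - 1) - 3 = 2 * k - 5" using k by simp
    ultimately show "size_approximable (2 * (k - 1) - 3) (\<lambda>n S. real (ind_count {..<k} H n S))" by simp
    show "\<forall>\<^sub>F n in sequentially. \<bar>?C\<bar> / 2 ^ k * real n ^ (k - 1 + 1) \<le>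
        \<bar>expect n (\<lambda>S. real (ind_count {..<k} H n S) * excess n S)\<bar>"
      using eventually_ge_at_top[of "2 * k"]
    proof eventually_elim
      case (elim n)
      have "expect n (\<lambda>S. real (ind_count {..<k} H n S) * excess n S) =
          expect n (\<lambda>S. 1 / ?aut * (real (card (embeddings k H n S)) * excess n S))"
        by (rule expect_cong) (simp add: ind)
      also have "\<dots> = ?C * real (card (injections k n))"
        unfolding expect_cmult expect_card_embeddings_excess[OF p H] by simp
      finally have eq: "\<bar>expect n (\<lambda>S. real (ind_count {..<k} H n S) * excess n S)\<bar> = \<bar>?C\<bar> * real (card (injections k n))"
        by (simp add: abs_mult)
      have "\<bar>?C\<bar> / 2 ^ k * real n ^ (k - 1 + 1) = \<bar>?C\<bar> * (real n / 2) ^ k"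
        using k by (simp add: power_divide)
      also have "\<dots> \<le> \<bar>?C\<bar> * real (card (injections k n))"
        using card_injections_ge[OF elim] by (rule mult_left_mono) simp
      finally show ?case unfolding eq .
    qed
    show "2 \<le> k - 1" using k by simp
    show "0 < \<bar>?C\<bar> / 2 ^ k" using C by (rule divide_pos_pos) simp
  qed
qed

end

section \<open>Counting the patterns of all quadruples\<close>

text \<open>Nested pairs serve as binary trees; \<open>True\<close> leads to the first component and
  \<open>False\<close> to the second.\<close>

fun upd :: "bool \<Rightarrow> ('a \<Rightarrow> 'a) \<Rightarrow> 'a \<times> 'a \<Rightarrow> 'a \<times> 'a" where
  "upd True f (u, v) = (f u, v)"
| "upd False f (u, v) = (u, f v)"

fun sel :: "bool \<Rightarrow> 'a \<times> 'a \<Rightarrow> 'a" where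
  "sel True (u, v) = u"
| "sel False (u, v) = v"

lemma sel_upd: "sel p (upd q f w) = (if p = q then f (sel p w) else sel p w)"
  by (cases p; cases q; cases w) auto

text \<open>
  Given the rows above the diagonal of an adjacency matrix, \<open>tally0\<close> counts how often each of the 64
  possible patterns occurs among the quadruples \<open>a < b < c < d\<close>. The counters are the leaves of a
  nested pair, addressed by the six adjacencies in the order \<open>ab, ac, bc, ad, bd, cd\<close>. They are binary
  numerals of type \<^typ>\<open>num\<close>, so that the whole computation consists of cheap rewriting steps; as
  this type has no zero, every counter is too large by one.
\<close>

primrec tally3 where
  "tally3 [] ys zs t = t"
| "tally3 (x # xs) ys zs t = tally3 xs (tl ys) (tl zs) (upd x (upd (hd ys) (upd (hd zs) Num.inc)) t)"

primrec tally2 where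
  "tally2 [] ys R t = t"
| "tally2 (x # xs) ys R t = tally2 xs (tl ys) (tl R) (upd x (upd (hd ys) (tally3 xs (tl ys) (hd R))) t)"

primrec tally1 where
  "tally1 [] R t = t"
| "tally1 (x # xs) R t = tally1 xs (tl R) (upd x (tally2 xs (hd R) (tl R)) t)"

primrec tally0 where
  "tally0 [] t = t"
| "tally0 (r # R) t = tally0 R (tally1 r R t)"

definition rows :: "(nat \<Rightarrow> nat \<Rightarrow> bool) \<Rightarrow> nat \<Rightarrow> nat \<Rightarrow> bool list list" where
  "rows adj n i = map (\<lambda>v. map (adj v) [Suc v..<n]) [i..<n]"

lemma rows_Cons: "i < n \<Longrightarrow> rows adj n i = map (adj i) [Suc i..<n] # rows adj n (Suc i)"
  by (simp add: rows_def upt_conv_Cons)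

text \<open>The maps \<open>\<alpha>\<close>, \<open>\<beta>\<close>, \<open>\<gamma>\<close> stand
  for the adjacencies of fixed vertices \<open>a\<close>, \<open>b\<close>, \<open>c\<close> to the
  candidates for \<open>d\<close>. The initial tree \<open>t\<close> stays arbitrary, as every step
  changes it.\<close>

lemma nat_of_num_tally3:
  "nat_of_num (sel r (sel q (sel p (tally3 (map \<alpha> ds) (map \<beta> ds) (map \<gamma> ds) t)))) =
   nat_of_num (sel r (sel q (sel p t))) + (\<Sum>d\<leftarrow>ds. of_bool (\<alpha> d = p \<and> \<beta> d = q \<and> \<gamma> d = r))"
  by (induction ds arbitrary: t) (auto simp: sel_upd nat_of_num_inc)

text \<open>With \<open>a\<close> and \<open>b\<close> fixed, \<open>\<alpha>\<close> and
  \<open>\<beta>\<close> are their adjacencies to the later vertices. The induction runs downwards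
  from \<open>n\<close> over the first candidate for \<open>c\<close>, so that all three lists grow
  together.\<close>

lemma nat_of_num_tally2:
  assumes "i \<le> n"
  shows "nat_of_num (sel cd (sel bd (sel ad (sel bc (sel ac
      (tally2 (map \<alpha> [i..<n]) (map \<beta> [i..<n]) (rows adj n i) t)))))) =
    nat_of_num (sel cd (sel bd (sel ad (sel bc (sel ac t))))) +
    (\<Sum>c=i..<n. \<Sum>d=Suc c..<n. of_bool (\<alpha> c = ac \<and> \<beta> c = bc \<and> \<alpha> d = ad \<and> \<beta> d = bd \<and> adj c d = cd))"
  using assms
proof (induction i arbitrary: t rule: inc_induct)
  case base
  then show ?case by simp
next
  case (step i)
  then show ?case
    by (simp add: upt_conv_Cons rows_Cons sel_upd nat_of_num_tally3 interv_sum_list_conv_sum_set_nat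
        sum.atLeast_Suc_lessThan)
qed

lemma nat_of_num_tally1:
  assumes "i \<le> n"
  shows "nat_of_num (sel cd (sel bd (sel ad (sel bc (sel ac (sel ab
      (tally1 (map \<alpha> [i..<n]) (rows adj n i) t))))))) =
    nat_of_num (sel cd (sel bd (sel ad (sel bc (sel ac (sel ab t)))))) +
    (\<Sum>b=i..<n. \<Sum>c=Suc b..<n. \<Sum>d=Suc c..<n. of_bool (\<alpha> b = ab \<and> \<alpha> c = ac \<and> adj b c = bc \<and>
       \<alpha> d = ad \<and> adj b d = bd \<and> adj c d = cd))"
  using assms
proof (induction i arbitrary: t rule: inc_induct)
  case base
  then show ?case by simp
next
  case (step i)
  then show ?case
    by (simp add: upt_conv_Cons rows_Cons sel_upd nat_of_num_tally2 sum.atLeast_Suc_lessThan)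
qed

lemma nat_of_num_tally0:
  assumes "i \<le> n"
  shows "nat_of_num (sel cd (sel bd (sel ad (sel bc (sel ac (sel ab (tally0 (rows adj n i) t))))))) =
    nat_of_num (sel cd (sel bd (sel ad (sel bc (sel ac (sel ab t)))))) +
    (\<Sum>a=i..<n. \<Sum>b=Suc a..<n. \<Sum>c=Suc b..<n. \<Sum>d=Suc c..<n.
       of_bool (adj a b = ab \<and> adj a c = ac \<and> adj b c = bc \<and> adj a d = ad \<and> adj b d = bd \<and> adj c d = cd))"
  using assms
proof (induction i arbitrary: t rule: inc_induct)
  case base
  then show ?case by (simp add: rows_def)
next
  case (step i)
  then show ?case
    by (simp add: rows_Cons nat_of_num_tally1 sum.atLeast_Suc_lessThan)
qed

section \<open>From increasing quadruples to all injections of four vertices\<close>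

definition "pattern E xs = ({xs ! 0, xs ! 1} \<in> E, {xs ! 0, xs ! 2} \<in> E, {xs ! 1, xs ! 2} \<in> E,
  {xs ! 0, xs ! 3} \<in> E, {xs ! 1, xs ! 3} \<in> E, {xs ! 2, xs ! 3} \<in> E)"

definition quad_count :: "(nat \<Rightarrow> nat \<Rightarrow> bool) \<Rightarrow> nat \<Rightarrow>
    bool \<Rightarrow> bool \<Rightarrow> bool \<Rightarrow>
    bool \<Rightarrow> bool \<Rightarrow> bool \<Rightarrow> nat" where
  "quad_count adj n ab ac bc ad bd cd = sum_quadruples n (\<lambda>a b c d.
     of_bool (adj a b = ab \<and> adj a c = ac \<and> adj b c = bc \<and> adj a d = ad \<and> adj b d = bd \<and> adj c d = cd))"

definition upper_edges :: "(nat \<Rightarrow> nat \<Rightarrow> bool) \<Rightarrow> nat \<Rightarrow> nat set set" where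
  "upper_edges adj n = {{i, j} |i j. i < j \<and> j < n \<and> adj i j}"

lemma upper_edges_iff: "i < j \<Longrightarrow> j < n \<Longrightarrow> {i, j} \<in> upper_edges adj n \<longleftrightarrow> adj i j"
  "i < j \<Longrightarrow> j < n \<Longrightarrow> {j, i} \<in> upper_edges adj n \<longleftrightarrow> adj i j"
  by (auto simp: upper_edges_def doubleton_eq_iff)

text \<open>The 24 summands correspond to the orderings of an increasing quadruple. Each ordering
  permutes the six adjacencies, which \<open>pattern\<close> lists in the same order as the
  addresses of the counters.\<close>

lemma card_injections_pattern:
  fixes adj :: "nat \<Rightarrow> nat \<Rightarrow> bool" and n :: nat and F
  defines "F \<equiv> quad_count adj n"
  shows "card {xs \<in> injections 4 n. pattern (upper_edges adj n) xs = (ab, ac, bc, ad, bd, cd)} =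
    F ab ac bc ad bd cd + F ab ad bd ac bc cd + F ac ab bc ad cd bd + F ad ab bd ac cd bc +
    F ac ad cd ab bc bd + F ad ac cd ab bd bc + F ab bc ac bd ad cd + F ab bd ad bc ac cd +
    F ac bc ab cd ad bd + F ad bd ab cd ac bc + F ac cd ad bc ab bd + F ad cd ac bd ab bc +
    F bc ab ac bd cd ad + F bd ab ad bc cd ac + F bc ac ab cd bd ad + F bd ad ab cd bc ac +
    F cd ac ad bc bd ab + F cd ad ac bd bc ab + F bc bd cd ab ac ad + F bd bc cd ab ad ac +
    F bc cd bd ac ab ad + F bd cd bc ad ab ac + F cd bc bd ac ad ab + F cd bd bc ad ac ab"
proof -
  let ?P = "\<lambda>xs. of_bool (pattern (upper_edges adj n) xs = (ab, ac, bc, ad, bd, cd)) :: nat"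
  let ?e = "\<lambda>a b c d ab ac bc ad bd cd. of_bool (adj a b = ab \<and> adj a c = ac \<and> adj b c = bc \<and>
    adj a d = ad \<and> adj b d = bd \<and> adj c d = cd) :: nat"
  have "card {xs \<in> injections 4 n. pattern (upper_edges adj n) xs = (ab, ac, bc, ad, bd, cd)} =
    (\<Sum>xs\<in>injections 4 n. ?P xs)"
    by (simp add: sum_of_bool_eq Int_def)
  also have "\<dots> = sum_quadruples n (\<lambda>a b c d. \<Sum>xs\<in>permutations_of_set {a, b, c, d}. ?P xs)"
    by (rule sum_injections_4)
  also have "\<dots> = sum_quadruples n (\<lambda>a b c d.
    ?e a b c d ab ac bc ad bd cd + ?e a b c d ab ad bd ac bc cd + ?e a b c d ac ab bc ad cd bd + ?e a b c d ad ab bd ac cd bc +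
    ?e a b c d ac ad cd ab bc bd + ?e a b c d ad ac cd ab bd bc + ?e a b c d ab bc ac bd ad cd + ?e a b c d ab bd ad bc ac cd +
    ?e a b c d ac bc ab cd ad bd + ?e a b c d ad bd ab cd ac bc + ?e a b c d ac cd ad bc ab bd + ?e a b c d ad cd ac bd ab bc +
    ?e a b c d bc ab ac bd cd ad + ?e a b c d bd ab ad bc cd ac + ?e a b c d bc ac ab cd bd ad + ?e a b c d bd ad ab cd bc ac +
    ?e a b c d cd ac ad bc bd ab + ?e a b c d cd ad ac bd bc ab + ?e a b c d bc bd cd ab ac ad + ?e a b c d bd bc cd ab ad ac +
    ?e a b c d bc cd bd ac ab ad + ?e a b c d bd cd bc ad ab ac + ?e a b c d cd bc bd ac ad ab + ?e a b c d cd bd bc ad ac ab)"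
  proof (intro sum.cong refl, goal_cases)
    case (1 a b c d)
    then have *: "a < b" "b < c" "c < d" "a < c" "b < d" "a < d" "b < n" "c < n" "d < n" by auto
    then have "distinct [a, b, c, d]" by auto
    show ?case
      unfolding sum_permutations_of_4[OF \<open>distinct [a, b, c, d]\<close>]
      by (simp add: pattern_def upper_edges_iff * numeral_eq_Suc conj_ac)
  qed
  also have "\<dots> = F ab ac bc ad bd cd + F ab ad bd ac bc cd + F ac ab bc ad cd bd + F ad ab bd ac cd bc +
    F ac ad cd ab bc bd + F ad ac cd ab bd bc + F ab bc ac bd ad cd + F ab bd ad bc ac cd +
    F ac bc ab cd ad bd + F ad bd ab cd ac bc + F ac cd ad bc ab bd + F ad cd ac bd ab bc +
    F bc ab ac bd cd ad + F bd ab ad bc cd ac + F bc ac ab cd bd ad + F bd ad ab cd bc ac +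
    F cd ac ad bc bd ab + F cd ad ac bd bc ab + F bc bd cd ab ac ad + F bd bc cd ab ad ac +
    F bc cd bd ac ab ad + F bd cd bc ad ab ac + F cd bc bd ac ad ab + F cd bd bc ad ac ab"
    unfolding F_def quad_count_def sum.distrib ..
  finally show ?thesis .
qed

lemma nat_of_num_tally0_rows:
  "nat_of_num (sel cd (sel bd (sel ad (sel bc (sel ac (sel ab (tally0 (rows adj n 0) t))))))) =
    nat_of_num (sel cd (sel bd (sel ad (sel bc (sel ac (sel ab t)))))) + quad_count adj n ab ac bc ad bd cd"
  by (simp add: nat_of_num_tally0 quad_count_def)

definition twice :: "'a \<Rightarrow> 'a \<times> 'a" where
  "twice x = (x, x)"

definition "ones = twice (twice (twice (twice (twice (twice num.One)))))"

lemma sel_twice: "sel b (twice x) = x"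
  by (cases b) (simp_all add: twice_def)

lemma sel_ones: "sel cd (sel bd (sel ad (sel bc (sel ac (sel ab ones))))) = num.One"
  by (simp add: ones_def sel_twice)

text \<open>In this form, without \<open>hd\<close> and \<open>tl\<close>, the recursion can be
  evaluated with very few rewrite rules.\<close>

lemma tally3_Cons: "tally3 (x # xs) (y # ys) (z # zs) t = tally3 xs ys zs (upd x (upd y (upd z Num.inc)) t)"
  and tally2_Cons: "tally2 (x # xs) (y # ys) (r # R) u = tally2 xs ys R (upd x (upd y (tally3 xs ys r)) u)"
  and tally1_Cons: "tally1 (x # xs) (r # R) v = tally1 xs R (upd x (tally2 xs r R) v)"
  by simp_all

section \<open>A graph on 64 vertices\<close>

text \<open>Binary digits, least significant first, in a list of fixed length.\<close>

primrec unpack :: "nat \<Rightarrow> int \<Rightarrow> bool list" where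
  "unpack 0 w = []"
| "unpack (Suc l) w = odd w # unpack l (w div 2)"

text \<open>Row \<open>i\<close> has \<open>63 - i\<close> entries: bit \<open>b\<close> of its
  number tells whether \<open>i\<close> is adjacent to \<open>i + 1 + b\<close>.\<close>

definition rows64 :: "bool list list" where
  "rows64 = map2 unpack (rev [0..<64]) [
    5355272213487024892, 786281920376733664, 1216751797039276576, 300364930545503359,
    15003490602734963, 98931294502684236, 142653566435742126, 39164753702493095,
    34478984238542100, 6064161452517384, 850807423581700, 964522770307193,
    1235875726354738, 146262850597056, 467950670202480, 255471495029111,
    15047487005574, 42462169259775, 11082113730742, 12796476496126,
    4930027940910, 1902462453536, 2085892334337, 928139816068,
    26946715486, 213946752151, 107297053998, 32950334385,
    23734271899, 16046739604, 5605772961, 2106340,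
    1623142850, 58538558, 228768024, 58872334,
    4608098, 22716634, 28395824, 9518742,
    7552925, 159190, 376180, 950498,
    208409, 234672, 123218, 15524,
    25425, 13014, 5631, 285,
    2041, 592, 401, 164,
    4, 55, 18, 8,
    3, 0, 0, 0]"

text \<open>Meaningful for \<open>i < j < 64\<close> only; row \<open>i\<close> starts with the
  entry for \<open>j = i + 1\<close>.\<close>

definition adj64 :: "nat \<Rightarrow> nat \<Rightarrow> bool" where
  "adj64 i j = rows64 ! i ! (j - Suc i)"


lemma length_unpack [simp]: "length (unpack l w) = l"
  by (induction l arbitrary: w) auto

lemma length_rows64: "length rows64 = 64"
  by (simp add: rows64_def)

lemma length_nth_rows64: "i < 64 \<Longrightarrow> length (rows64 ! i) = 63 - i"
  by (simp add: rows64_def rev_nth)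

lemma rows_adj64: "rows adj64 64 0 = rows64"
proof (rule nth_equalityI)
  show "rows adj64 64 0 ! i = rows64 ! i" if "i < length (rows adj64 64 0)" for i
    using that by (intro nth_equalityI) (auto simp: rows_def length_nth_rows64 adj64_def)
qed (simp add: rows_def length_rows64)

schematic_goal rows64_eval: "rows64 = ?R"
  unfolding rows64_def
  by (simp add: upt_rec numeral_eq_Suc)

\<comment> \<open>The evaluation itself: one increment for each of the 635376 increasing quadruples.
  The resulting tree instantiates the schematic right-hand side.\<close>
schematic_goal tally0_rows64: "tally0 rows64 ones = ?t"
  unfolding rows64_eval ones_def twice_def
  by (simp only: tally0.simps tally1.simps(1) tally1_Cons tally2.simps(1) tally2_Cons
      tally3.simps(1) tally3_Cons upd.simps Num.inc.simps)

lemma quad_count_adj64: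
  "nat_of_num (sel cd (sel bd (sel ad (sel bc (sel ac (sel ab (tally0 rows64 ones))))))) =
    1 + quad_count adj64 64 ab ac bc ad bd cd"
  using nat_of_num_tally0_rows[of cd bd ad bc ac ab adj64 64 ones]
  by (simp add: rows_adj64 sel_ones)

text \<open>Over the integers the initial value 1 of a counter can be subtracted and the counts can
  be compared with a formula in signs.\<close>

lemma int_quad_count_adj64:
  "int (quad_count adj64 64 ab ac bc ad bd cd) =
    int (nat_of_num (sel cd (sel bd (sel ad (sel bc (sel ac (sel ab (tally0 rows64 ones)))))))) - 1"
  using quad_count_adj64[of cd bd ad bc ac ab] by simp

text \<open>This graph was found by simulated annealing.\<close>

definition "edges64 = upper_edges adj64 64"

definition bsign :: "bool \<Rightarrow> int" where
  "bsign b = (if b then 1 else -1)"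

lemma bsign_simps [simp]: "bsign True = 1" "bsign False = -1"
  by (simp_all add: bsign_def)

text \<open>
  The right-hand side shows that only the empty graph, the six edges and the three perfect matchings
  have a nonzero Walsh coefficient in the distribution of patterns.
\<close>

lemma card_injections_pattern_edges64:
  "int (card {xs \<in> injections 4 64. pattern edges64 xs = (ab, ac, bc, ad, bd, cd)}) =
    238266 - 7564 * (bsign ab + bsign ac + bsign bc + bsign ad + bsign bd + bsign cd) +
    130 * (bsign ab * bsign cd + bsign ac * bsign bd + bsign bc * bsign ad)"
  unfolding edges64_def card_injections_pattern of_nat_add int_quad_count_adj64
  by (cases ab; cases ac; cases bc; cases ad; cases bd; cases cd)
    (simp_all only: tally0_rows64 sel.simps, simp_all add: nat_of_num_numeral)

section \<open>Walsh coefficients of the pattern distribution and conclusion\<close>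

definition flagged :: "bool \<Rightarrow> bool \<Rightarrow> int" where
  "flagged f b = (if f then bsign b else 1)"

text \<open>The Walsh character that belongs to the set of flagged edges of the complete graph on
  four vertices.\<close>

definition pattern_sign :: "bool \<Rightarrow> bool \<Rightarrow> bool \<Rightarrow> bool \<Rightarrow> bool \<Rightarrow> bool \<Rightarrow>
    bool \<times> bool \<times> bool \<times> bool \<times> bool \<times> bool \<Rightarrow> int" where
  "pattern_sign fab fac fbc fad fbd fcd = (\<lambda>(ab, ac, bc, ad, bd, cd).
     flagged fab ab * flagged fac ac * flagged fbc bc * flagged fad ad * flagged fbd bd * flagged fcd cd)"

lemma sum_UNIV_bool6:
  fixes f :: "bool \<times> bool \<times> bool \<times> bool \<times> bool \<times> bool \<Rightarrow> 'a::comm_monoid_add"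
  shows "(\<Sum>g\<in>UNIV. f g) = (\<Sum>ab\<in>UNIV. \<Sum>ac\<in>UNIV. \<Sum>bc\<in>UNIV.
    \<Sum>ad\<in>UNIV. \<Sum>bd\<in>UNIV. \<Sum>cd\<in>UNIV. f (ab, ac, bc, ad, bd, cd))"
  by (simp only: UNIV_Times_UNIV[symmetric] sum.cartesian_product split_def prod.collapse)

lemma sum_injections_pattern:
  "(\<Sum>xs\<in>injections 4 n. f (pattern E xs)) =
    (\<Sum>g\<in>UNIV. int (card {xs \<in> injections 4 n. pattern E xs = g}) * f g)"
proof -
  have "(\<Sum>xs\<in>injections 4 n. f (pattern E xs)) =
    (\<Sum>g\<in>UNIV. \<Sum>xs\<in>{xs \<in> injections 4 n. pattern E xs = g}. f (pattern E xs))"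
    by (rule sum.group[symmetric]) auto
  also have "\<dots> = (\<Sum>g\<in>UNIV. int (card {xs \<in> injections 4 n. pattern E xs = g}) * f g)"
    by (intro sum.cong refl) simp
  finally show ?thesis .
qed

text \<open>The hypothesis runs through the twelve pairs of adjacent edges on four vertices, so the
  flagged edges do not form a matching. By \<open>card_injections_pattern_edges64\<close> the
  distribution is a combination of characters of matchings, which are orthogonal to this
  one.\<close>

lemma sum_pattern_sign_edges64_zero:
  assumes "fab \<and> fac \<or> fab \<and> fbc \<or> fab \<and> fad \<or> fab \<and> fbd \<or> fac \<and> fbc \<or> fac \<and> fad \<or> fac \<and> fcd \<or>
    fbc \<and> fbd \<or> fbc \<and> fcd \<or> fad \<and> fbd \<or> fad \<and> fcd \<or> fbd \<and> fcd"
  shows "(\<Sum>xs\<in>injections 4 64. pattern_sign fab fac fbc fad fbd fcd (pattern edges64 xs)) = 0"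
  using assms
  unfolding sum_injections_pattern sum_UNIV_bool6 card_injections_pattern_edges64 pattern_sign_def
  by (cases fab; cases fac; cases fbc; cases fad; cases fbd; cases fcd)
    (simp_all add: flagged_def UNIV_bool)

text \<open>The value is the coefficient -7564 of \<open>bsign ab\<close> times the number 64 of
  patterns.\<close>

lemma sum_pattern_sign_edges64_single:
  "(\<Sum>xs\<in>injections 4 64. pattern_sign True False False False False False (pattern edges64 xs)) = -484096"
  unfolding sum_injections_pattern sum_UNIV_bool6 card_injections_pattern_edges64 pattern_sign_def
  by (simp add: flagged_def UNIV_bool)

lemma all_edges_4: "all_edges 4 = {{0, 1}, {0, 2}, {1, 2}, {0, 3}, {1, 3}, {2, 3}}"
proof
  show "all_edges 4 \<subseteq> {{0, 1}, {0, 2}, {1, 2}, {0, 3}, {1, 3}, {2, 3}}"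
  proof
    fix e assume "e \<in> all_edges 4"
    then obtain i j :: nat where *: "i < 4" "j < 4" "i \<noteq> j" "e = {i, j}" by (auto simp: all_edges_def)
    have "i = 0 \<or> i = 1 \<or> i = 2 \<or> i = 3" "j = 0 \<or> j = 1 \<or> j = 2 \<or> j = 3" using * by auto
    then show "e \<in> {{0, 1}, {0, 2}, {1, 2}, {0, 3}, {1, 3}, {2, 3}}"
      using *(3,4) by (elim disjE) (simp_all add: insert_commute)
  qed
  show "{{0, 1}, {0, 2}, {1, 2}, {0, 3}, {1, 3}, {2, 3}} \<subseteq> all_edges 4"
    by (simp add: all_edgesI)
qed

lemma prod_edge_sign_4:
  assumes "G \<subseteq> all_edges 4"
  shows "(\<Prod>e\<in>G. edge_sign E ((!) xs ` e)) =
    of_int (pattern_sign ({0, 1} \<in> G) ({0, 2} \<in> G) ({1, 2} \<in> G)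
      ({0, 3} \<in> G) ({1, 3} \<in> G) ({2, 3} \<in> G) (pattern E xs))"
proof -
  have "(\<Prod>e\<in>G. edge_sign E ((!) xs ` e)) = (\<Prod>e\<in>all_edges 4. if e \<in> G then edge_sign E ((!) xs ` e) else 1)"
    by (rule prod.mono_neutral_cong_left) (use assms in \<open>auto simp: all_edges_4\<close>)
  also have "\<dots> = of_int (pattern_sign ({0, 1} \<in> G) ({0, 2} \<in> G) ({1, 2} \<in> G)
      ({0, 3} \<in> G) ({1, 3} \<in> G) ({2, 3} \<in> G) (pattern E xs))"
    unfolding all_edges_4
    by (simp add: doubleton_eq_iff pattern_sign_def pattern_def flagged_def edge_sign_def bsign_def)
  finally show ?thesis .
qed

text \<open>A set that is not a matching contains two edges with a common vertex, which is one of
  the twelve cases of \<open>sum_pattern_sign_edges64_zero\<close>.\<close>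

lemma sum_prod_edge_sign_edges64:
  assumes "G \<subseteq> all_edges 4" "\<not> pairwise disjnt G"
  shows "(\<Sum>xs\<in>injections 4 64. \<Prod>e\<in>G. edge_sign edges64 ((!) xs ` e)) = 0"
proof -
  obtain e e' where e: "e \<in> G" "e' \<in> G" "e \<noteq> e'" "e \<inter> e' \<noteq> {}"
    using assms(2) by (auto simp: pairwise_def disjnt_def)
  have "e \<in> all_edges 4" "e' \<in> all_edges 4" using e assms(1) by blast+
  then have e_cases: "e = {0, 1} \<or> e = {0, 2} \<or> e = {1, 2} \<or> e = {0, 3} \<or> e = {1, 3} \<or> e = {2, 3}"
    and e'_cases: "e' = {0, 1} \<or> e' = {0, 2} \<or> e' = {1, 2} \<or> e' = {0, 3} \<or> e' = {1, 3} \<or> e' = {2, 3}"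
    by (simp_all only: all_edges_4 insert_iff empty_iff simp_thms)
  have "{0, 1} \<in> G \<and> {0, 2} \<in> G \<or> {0, 1} \<in> G \<and> {1, 2} \<in> G \<or> {0, 1} \<in> G \<and> {0, 3} \<in> G \<or>
    {0, 1} \<in> G \<and> {1, 3} \<in> G \<or> {0, 2} \<in> G \<and> {1, 2} \<in> G \<or> {0, 2} \<in> G \<and> {0, 3} \<in> G \<or>
    {0, 2} \<in> G \<and> {2, 3} \<in> G \<or> {1, 2} \<in> G \<and> {1, 3} \<in> G \<or> {1, 2} \<in> G \<and> {2, 3} \<in> G \<or>
    {0, 3} \<in> G \<and> {1, 3} \<in> G \<or> {0, 3} \<in> G \<and> {2, 3} \<in> G \<or> {1, 3} \<in> G \<and> {2, 3} \<in> G"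
    using e_cases e'_cases e by - (elim disjE; simp)
  from sum_pattern_sign_edges64_zero[OF this]
  show ?thesis unfolding prod_edge_sign_4[OF assms(1)] of_int_sum[symmetric] by simp
qed

lemma sum_edge_sign_edges64:
  "(\<Sum>xs\<in>injections 4 64. edge_sign edges64 {xs ! 0, xs ! 1}) = -484096"
proof -
  have "(\<Sum>xs\<in>injections 4 64. edge_sign edges64 {xs ! 0, xs ! 1}) =
    of_int (\<Sum>xs\<in>injections 4 64. pattern_sign True False False False False False (pattern edges64 xs))"
    unfolding of_int_sum
    by (intro sum.cong refl) (simp add: pattern_sign_def pattern_def flagged_def edge_sign_def bsign_def)
  then show ?thesis
    unfolding sum_pattern_sign_edges64_single by simp
qed

lemma edges64_subset: "edges64 \<subseteq> all_edges 64"
proof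
  fix e assume "e \<in> edges64"
  then obtain i j where "e = {i, j}" "i < j" "j < 64" by (auto simp: edges64_def upper_edges_def)
  then show "e \<in> all_edges 64" using all_edgesI[of i 64 j] by auto
qed

text \<open>Every pair of vertices is counted \<open>2 * 62 * 61 = 7564\<close> times in the sum
  over injections, so the graph has 64 fewer edges than non-edges.\<close>

lemma sum_edge_sign_edges64_nonzero: "(\<Sum>e\<in>all_edges 64. edge_sign edges64 e) \<noteq> 0"
proof
  assume zero: "(\<Sum>e\<in>all_edges 64. edge_sign edges64 e) = 0"
  have "(\<Sum>xs\<in>injections 4 64. edge_sign edges64 {xs ! 0, xs ! 1}) =
      (\<Sum>xs\<in>injections 4 64. (\<lambda>ys. edge_sign edges64 {ys ! 0, ys ! 1}) (take 2 xs))"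
    by simp
  also have "\<dots> = (\<Prod>i=2..<4. real (64 - i)) * (2 * (\<Sum>e\<in>all_edges 64. edge_sign edges64 e))"
    using sum_injections_take[of 2 4 "\<lambda>ys. edge_sign edges64 {ys ! 0, ys ! 1}" 64]
    unfolding sum_injections_2[where f = "edge_sign edges64"] by simp
  finally show False using zero sum_edge_sign_edges64 by simp
qed

theorem theorem1p5:
  shows "(\<forall>p::real. 0 < p \<and> p < 1 \<longrightarrow>
           (\<exists>c>0. \<forall>\<^sub>F n in sequentially.
              max_point_prob (gnp n p) (\<lambda>E. real (sub_count two_K2_V two_K2_E n E))
                \<ge> c * sqrt (real n) / std_dev (gnp n p) (\<lambda>E. real (sub_count two_K2_V two_K2_E n E))))
       \<and> (\<exists>EH'. EH' \<subseteq> all_edges 64 \<and>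
           (\<exists>c>0. \<forall>\<^sub>F n in sequentially.
              max_point_prob (gnp n (1/2)) (\<lambda>E. real (ind_count {..<64} EH' n E))
                \<ge> c * sqrt (real n) / std_dev (gnp n (1/2)) (\<lambda>E. real (ind_count {..<64} EH' n E))))"
proof (intro conjI allI impI)
  fix p :: real
  assume "0 < p \<and> p < 1"
  then interpret random_graph p by unfold_locales auto
  show "\<exists>c>0. \<forall>\<^sub>F n in sequentially.
      max_point_prob (gnp n p) (\<lambda>E. real (sub_count two_K2_V two_K2_E n E))
        \<ge> c * sqrt (real n) / std_dev (gnp n p) (\<lambda>E. real (sub_count two_K2_V two_K2_E n E))"
    by (rule two_K2_anticoncentration_failure)
next
  interpret random_graph "1 / 2" by unfold_locales auto
  have "\<exists>c>0. \<forall>\<^sub>F n in sequentially.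
      max_point_prob (gnp n (1/2)) (\<lambda>E. real (ind_count {..<64} edges64 n E))
        \<ge> c * sqrt (real n) / std_dev (gnp n (1/2)) (\<lambda>E. real (ind_count {..<64} edges64 n E))"
    by (rule induced_anticoncentration_failure)
      (simp_all add: edges64_subset sum_prod_edge_sign_edges64 sum_edge_sign_edges64_nonzero)
  then show "\<exists>EH'. EH' \<subseteq> all_edges 64 \<and>
      (\<exists>c>0. \<forall>\<^sub>F n in sequentially.
        max_point_prob (gnp n (1/2)) (\<lambda>E. real (ind_count {..<64} EH' n E))
          \<ge> c * sqrt (real n) / std_dev (gnp n (1/2)) (\<lambda>E. real (ind_count {..<64} EH' n E)))"
    using edges64_subset by blast
qed

end
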